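(* Consider the normal model with known variance: $x\sim \mathrm{N}_d(\mu,\sigma^2 I_d)$ is observed and an independent $y\sim\mathrm{N}_d(\mu,\sigma^2 I_d)$ is to be predicted, where $\mu\in\mathbb{R}^d$ is unknown and $\sigma^2>0$ is known. If the prior $\pi(\mu)$ on $\mathbb{R}^d$ is superharmonic, then the Bayesian predictive density with respect to $\pi(\mu)$ is minimax under the $L^2$ Wasserstein loss.
   Context: A predictive density is a (measurable) family $\hat{p}(\cdot\mid x)$ of probability densities on $\mathbb{R}^d$ indexed by $x\in\mathbb{R}^d$. Write $p(\cdot\mid\mu)$ for the density of $\mathrm{N}_d(\mu,\sigma^2I_d)$. For probability distributions $p_1,p_2$ on $\mathbb{R}^d$, $W_2(p_1,p_2)=\inf_{X,Y}\mathrm{E}[\|X-Y\|^2]^{1/2}$, the infimum being over all joint distributions of $(X,Y)$ with marginals $p_1$ and $p_2$. The $L^2$ Wasserstein loss is $W_2(p(\cdot\mid\mu),\hat{p}(\cdot\mid x))^2$ and the risk is $R(\mu,\hat{p})=\int W_2(p(\cdot\mid\mu),\hat{p}(\cdot\mid x))^2\,p(x\mid\mu)\,\mathrm{d}x$. A superharmonic prior is a prior (possibly improper) whose density $\pi:\mathbb{R}^d\to[0,\infty]$ is a superharmonic function, not identically $0$ or $\infty$. The Bayesian predictive density with respect to $\pi$ is the one minimizing the average risk $\int R(\mu,\hat{p})\pi(\mu)\,\mathrm{d}\mu$ (for an improper prior, minimizing for each $x$ the posterior expected loss); it is the density of $\mathrm{N}_d(\hat{\mu}^\pi(x),\sigma^2I_d)$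 with $\hat{\mu}^{\pi}(x)=\int\mu\,p(x\mid\mu)\pi(\mu)\,\mathrm{d}\mu\big/\int p(x\mid\mu)\pi(\mu)\,\mathrm{d}\mu$. A predictive density $\hat{p}_*$ is minimax if $\sup_\mu R(\mu,\hat{p}_* )=\min_{\hat{p}}\sup_\mu R(\mu,\hat{p})$, the minimum being over all predictive densities. *)

theory Defs
  imports "HOL-Probability.Probability"
begin

text \<open>The sample space \<open>\<real>\<^sup>d\<close> is an arbitrary Euclidean space, with \<open>d = DIM('a)\<close>. Distances,
  losses and risks may be infinite and are therefore valued in \<^typ>\<open>ennreal\<close>.\<close>

section \<open>Densities and predictive densities\<close>

definition mvn_density :: "real \<Rightarrow> 'a::euclidean_space \<Rightarrow> 'a \<Rightarrow> real" where
  "mvn_density \<sigma> \<mu> x =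
     exp (- (norm (x - \<mu>))\<^sup>2 / (2 * \<sigma>\<^sup>2)) / sqrt (2 * pi * \<sigma>\<^sup>2) ^ DIM('a)"

definition is_pdf :: "('a::euclidean_space \<Rightarrow> real) \<Rightarrow> bool" where
  "is_pdf q \<longleftrightarrow> q \<in> borel_measurable borel \<and> (\<forall>y. 0 \<le> q y) \<and> (\<integral>\<^sup>+ y. ennreal (q y) \<partial>lborel) = 1"

text \<open>Here \<open>p x y\<close> stands for \<open>p(y | x)\<close>.\<close>

definition predictive_density :: "('a::euclidean_space \<Rightarrow> 'a \<Rightarrow> real) \<Rightarrow> bool" where
  "predictive_density p \<longleftrightarrow>
     (\<lambda>(x, y). p x y) \<in> borel_measurable (borel \<Otimes>\<^sub>M borel) \<and> (\<forall>x. is_pdf (p x))"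

section \<open>The \<open>L\<^sup>2\<close> Wasserstein loss\<close>

definition couplings :: "'a::euclidean_space measure \<Rightarrow> 'a measure \<Rightarrow> ('a \<times> 'a) measure set" where
  "couplings M N = {\<gamma>. sets \<gamma> = sets (borel \<Otimes>\<^sub>M borel) \<and>
                       distr \<gamma> borel fst = M \<and> distr \<gamma> borel snd = N}"

definition ennreal_sqrt :: "ennreal \<Rightarrow> ennreal" where
  "ennreal_sqrt t = (if t = \<infinity> then \<infinity> else ennreal (sqrt (enn2real t)))"

definition wasserstein2 :: "'a::euclidean_space measure \<Rightarrow> 'a measure \<Rightarrow> ennreal" where
  "wasserstein2 M N =
     (INF \<gamma>\<in>couplings M N. ennreal_sqrt (\<integral>\<^sup>+ z. ennreal ((norm (fst z - snd z))\<^sup>2) \<partial>\<gamma>))"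

definition wasserstein_loss :: "real \<Rightarrow> 'a::euclidean_space \<Rightarrow> ('a \<Rightarrow> real) \<Rightarrow> ennreal" where
  "wasserstein_loss \<sigma> \<mu> q =
     (wasserstein2 (density lborel (mvn_density \<sigma> \<mu>)) (density lborel q))\<^sup>2"

definition risk :: "real \<Rightarrow> 'a::euclidean_space \<Rightarrow> ('a \<Rightarrow> 'a \<Rightarrow> real) \<Rightarrow> ennreal" where
  "risk \<sigma> \<mu> p = (\<integral>\<^sup>+ x. wasserstein_loss \<sigma> \<mu> (p x) * ennreal (mvn_density \<sigma> \<mu> x) \<partial>lborel)"

definition minimax :: "real \<Rightarrow> ('a::euclidean_space \<Rightarrow> 'a \<Rightarrow> real) \<Rightarrow> bool" where
  "minimax \<sigma> p \<longleftrightarrow> is_arg_min (\<lambda>q. SUP \<mu>. risk \<sigma> \<mu> q) predictive_density p"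

section \<open>Superharmonic priors\<close>

text \<open>Lower semicontinuity together with the super-mean-value inequality over all balls of \<open>\<real>\<^sup>d\<close>.\<close>

definition superharmonic :: "('a::euclidean_space \<Rightarrow> ennreal) \<Rightarrow> bool" where
  "superharmonic f \<longleftrightarrow>
     (\<forall>a. open {x. a < f x}) \<and>
     (\<forall>x. \<forall>r>0. (\<integral>\<^sup>+ y. f y \<partial>uniform_measure lborel (ball x r)) \<le> f x)"

definition superharmonic_prior :: "('a::euclidean_space \<Rightarrow> ennreal) \<Rightarrow> bool" where
  "superharmonic_prior \<pi> \<longleftrightarrow> superharmonic \<pi> \<and> \<pi> \<noteq> (\<lambda>_. 0) \<and> \<pi> \<noteq> (\<lambda>_. \<infinity>)"

section \<open>Bayesian predictive densities\<close>

definition posterior_loss ::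
  "real \<Rightarrow> ('a::euclidean_space \<Rightarrow> ennreal) \<Rightarrow> 'a \<Rightarrow> ('a \<Rightarrow> real) \<Rightarrow> ennreal" where
  "posterior_loss \<sigma> \<pi> x q =
     (\<integral>\<^sup>+ \<mu>. wasserstein_loss \<sigma> \<mu> q * (ennreal (mvn_density \<sigma> \<mu> x) * \<pi> \<mu>) \<partial>lborel) /
     (\<integral>\<^sup>+ \<mu>. ennreal (mvn_density \<sigma> \<mu> x) * \<pi> \<mu> \<partial>lborel)"

definition bayes_predictive_density ::
  "real \<Rightarrow> ('a::euclidean_space \<Rightarrow> ennreal) \<Rightarrow> ('a \<Rightarrow> 'a \<Rightarrow> real) \<Rightarrow> bool" where
  "bayes_predictive_density \<sigma> \<pi> p \<longleftrightarrow> predictive_density p \<and>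
     (if (\<integral>\<^sup>+ \<mu>. \<pi> \<mu> \<partial>lborel) < \<infinity>
      then is_arg_min (\<lambda>q. \<integral>\<^sup>+ \<mu>. risk \<sigma> \<mu> q * \<pi> \<mu> \<partial>lborel) predictive_density p
      else \<forall>x. is_arg_min (posterior_loss \<sigma> \<pi> x) is_pdf (p x))"

text \<open>The use of \<^const>\<open>enn2real\<close> sends the value \<open>\<infinity>\<close> to \<open>0\<close>; a superharmonic prior takes the
  value \<open>\<infinity>\<close> only on a null set, so the integrals are unaffected.\<close>

definition posterior_mean :: "real \<Rightarrow> ('a::euclidean_space \<Rightarrow> ennreal) \<Rightarrow> 'a \<Rightarrow> 'a" where
  "posterior_mean \<sigma> \<pi> x =
     (\<integral>\<mu>. (mvn_density \<sigma> \<mu> x * enn2real (\<pi> \<mu>)) *\<^sub>R \<mu> \<partial>lborel) /\<^sub>R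
     (\<integral>\<mu>. mvn_density \<sigma> \<mu> x * enn2real (\<pi> \<mu>) \<partial>lborel)"

end

theory Submission
  imports Defs
begin

text \<open>For a density \<open>q\<close> with mean \<open>m\<close> and finite second moment, translating couplings gives
  \<open>W\<^sub>2(N(\<mu>, \<sigma>\<^sup>2 I), q)\<^sup>2 = \<bar>\<mu> - m\<bar>\<^sup>2 + W\<^sub>2(N(m, \<sigma>\<^sup>2 I), q)\<^sup>2\<close>. So the loss of a predictive density
  dominates the quadratic loss of its mean, a Bayes predictive density has the loss
  \<open>\<bar>\<mu> - T x\<bar>\<^sup>2\<close> with \<open>T\<close> the posterior mean, and everything reduces to Stein's theorem that \<open>T\<close> has
  quadratic risk at most \<open>d \<sigma>\<^sup>2\<close>, the minimax value. The only input from superharmonicity is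
  \<open>E (\<bar>\<mu> - x\<bar>\<^sup>2 | x) \<le> d \<sigma>\<^sup>2\<close>: Gaussian averages of \<open>\<pi>\<close> decrease with the variance. This also makes
  \<open>T\<close> Lipschitz with \<open>T x - x\<close> bounded, so that Stein's identity applies to \<open>T\<close> without further growth
  conditions. A superharmonic prior is never integrable, so the Bayes property is always the
  pointwise one.\<close>

section \<open>Gaussian densities\<close>

text \<open>The quantity \<open>E (|\<mu> - x|^2 | x)\<close> is the trace of the posterior
  covariance plus \<open>|T x - x|^2\<close>, so one bound controls spread and displacement
  together. Analytically it equals \<open>d \<sigma>^2 + \<sigma>^4 \<Delta>m / m\<close>, with
  \<open>m\<close> the Gaussian smoothing of \<pi>, and this is why superharmonicity gives exactly
  the constant \<open>d \<sigma>^2\<close>. The obstacle is that \<pi> is merely lower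
  semicontinuous, may be infinite at some points and has no gradient. Hence all derivatives are put
  on the Gaussian kernel, and domination comes from a wider Gaussian centred at a point where \<pi>
  is finite. A second obstacle lies in the lower bound: for an arbitrary competitor, measurability
  of the Wasserstein loss in \<open>x\<close> is not established. A measurable minorant, made of the
  mean and the second moment, is averaged instead; Gaussian priors are chosen because their
  posteriors are explicit.\<close>

lemma mvn_density_nonneg [simp]: "0 \<le> mvn_density \<sigma> \<mu> x"
  by (simp add: mvn_density_def)

lemma mvn_density_pos: "\<sigma> > 0 \<Longrightarrow> 0 < mvn_density \<sigma> \<mu> x"
  by (simp add: mvn_density_def)

lemma mvn_density_commute: "mvn_density \<sigma> \<mu> x = mvn_density \<sigma> x \<mu>"
  by (simp add: mvn_density_def norm_minus_commute)

lemma mvn_density_measurable [measurable (raw)]: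
  fixes f g :: "'b \<Rightarrow> 'a::euclidean_space"
  assumes [measurable]: "f \<in> borel_measurable M" "g \<in> borel_measurable M"
  shows "(\<lambda>x. mvn_density \<sigma> (f x) (g x)) \<in> borel_measurable M"
  unfolding mvn_density_def by measurable

lemma mvn_density_eq_prod:
  fixes \<mu> x :: "'a::euclidean_space"
  assumes "\<sigma> > 0"
  shows "mvn_density \<sigma> \<mu> x = (\<Prod>b\<in>Basis. normal_density (\<mu> \<bullet> b) \<sigma> (x \<bullet> b))"
proof -
  have "(norm (x - \<mu>))\<^sup>2 = (\<Sum>b\<in>Basis. (x \<bullet> b - \<mu> \<bullet> b)\<^sup>2)"
    unfolding power2_norm_eq_inner
    by (subst euclidean_inner) (simp add: inner_diff_left power2_eq_square)
  then show ?thesis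
    by (simp add: mvn_density_def normal_density_def prod_dividef exp_sum [symmetric]
        sum_negf sum_divide_distrib)
qed

lemma nn_integral_mvn_density:
  fixes \<mu> :: "'a::euclidean_space"
  assumes "\<sigma> > 0"
  shows "(\<integral>\<^sup>+ x. ennreal (mvn_density \<sigma> \<mu> x) \<partial>lborel) = 1"
proof -
  have 1: "(\<integral>\<^sup>+ x. ennreal (normal_density m \<sigma> x) \<partial>lborel) = 1" for m
    using assms by (subst nn_integral_eq_integral) auto
  have "(\<integral>\<^sup>+ x. ennreal (mvn_density \<sigma> \<mu> x) \<partial>lborel) =
      (\<integral>\<^sup>+ x. (\<Prod>b\<in>Basis. ennreal (normal_density (\<mu> \<bullet> b) \<sigma> (x \<bullet> b))) \<partial>lborel)"
    using assms by (simp add: mvn_density_eq_prod prod_ennreal)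
  also have "\<dots> = 1"
    by (subst nn_integral_lborel_prod) (simp_all add: 1)
  finally show ?thesis .
qed

lemma integrable_mvn_density [simp]: "\<sigma> > 0 \<Longrightarrow> integrable lborel (mvn_density \<sigma> \<mu>)"
  by (rule integrableI_nonneg) (auto simp: nn_integral_mvn_density)

lemma integral_mvn_density [simp]: "\<sigma> > 0 \<Longrightarrow> (\<integral>x. mvn_density \<sigma> \<mu> x \<partial>lborel) = 1"
  by (rule integral_eq_nn_integral[THEN trans]) (auto simp: nn_integral_mvn_density)

lemma is_pdf_mvn_density: "\<sigma> > 0 \<Longrightarrow> is_pdf (mvn_density \<sigma> \<mu>)"
  by (simp add: is_pdf_def nn_integral_mvn_density)

text \<open>The exponent identity behind the Gaussian posterior, with \<open>p = |a|^2\<close>,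
  \<open>q = a . b\<close>, \<open>r = |b|^2\<close>: completing the square in \<open>b\<close>
  gives the centre \<open>(T / R) a\<close> and the variance \<open>S * T / R\<close>.\<close>

lemma completed_square:
  fixes p q r S T R :: real
  assumes "S > 0" "T > 0" "R = S + T"
  shows "(p - 2 * q + r) / (2 * S) + r / (2 * T) =
    p / (2 * R) + (r - 2 * (T / R) * q + (T / R)\<^sup>2 * p) / (2 * (S * T / R))"
proof -
  have "R > 0" using assms by simp
  have "(r - 2 * (T / R) * q + (T / R)\<^sup>2 * p) / (2 * (S * T / R)) =
     r * R / (2 * S * T) - q / S + T * p / (2 * S * R)"
    using assms(1,2) \<open>R > 0\<close> by (simp add: field_simps power2_eq_square)
  moreover have "r * R / (2 * S * T) = r / (2 * T) + r / (2 * S)"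
    using assms by (simp add: field_simps)
  moreover have "p / (2 * S) = p / (2 * R) + T * p / (2 * S * R)"
    using assms \<open>R > 0\<close> by (simp add: divide_simps) (simp add: algebra_simps)
  ultimately show ?thesis by (simp add: diff_divide_distrib add_divide_distrib)
qed

text \<open>Bayes' formula for a Gaussian prior with centre \<open>c\<close>: likelihood times prior
  is marginal times posterior. It yields both the semigroup property of Gaussian smoothing and the
  explicit posteriors of the minimax lower bound.\<close>

lemma mvn_density_mult:
  fixes c x \<mu> :: "'a::euclidean_space"
  assumes "\<sigma> > 0" "\<tau> > 0"
  defines "\<rho> \<equiv> sqrt (\<sigma>\<^sup>2 + \<tau>\<^sup>2)"
  shows "mvn_density \<sigma> \<mu> x * mvn_density \<tau> c \<mu> =
    mvn_density \<rho> c x * mvn_density (\<sigma> * \<tau> / \<rho>) (c + (\<tau>\<^sup>2 / \<rho>\<^sup>2) *\<^sub>R (x - c)) \<mu>"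
proof -
  define a where "a = x - c"
  define b where "b = \<mu> - c"
  have \<rho>2: "\<rho>\<^sup>2 = \<sigma>\<^sup>2 + \<tau>\<^sup>2" and pos: "\<rho> > 0"
    using assms by (simp_all add: \<rho>_def add_pos_pos)
  have "(norm (a - b))\<^sup>2 / (2 * \<sigma>\<^sup>2) + (norm b)\<^sup>2 / (2 * \<tau>\<^sup>2) =
      (norm a)\<^sup>2 / (2 * \<rho>\<^sup>2) + (norm (b - (\<tau>\<^sup>2 / \<rho>\<^sup>2) *\<^sub>R a))\<^sup>2 / (2 * (\<sigma> * \<tau> / \<rho>)\<^sup>2)"
  proof -
    have 1: "(norm (a - b))\<^sup>2 = a \<bullet> a - 2 * (a \<bullet> b) + b \<bullet> b"
      unfolding power2_norm_eq_inner by (simp add: inner_diff_left inner_diff_right inner_commute)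
    have 2: "(norm (b - k *\<^sub>R a))\<^sup>2 = b \<bullet> b - 2 * k * (a \<bullet> b) + k\<^sup>2 * (a \<bullet> a)" for k
      unfolding power2_norm_eq_inner
      by (simp add: inner_diff_left inner_diff_right inner_commute power2_eq_square)
    show ?thesis
      unfolding 1 2 power2_norm_eq_inner[of a] power2_norm_eq_inner[of b]
      using completed_square[of "\<sigma>\<^sup>2" "\<tau>\<^sup>2" "\<rho>\<^sup>2" "a \<bullet> a" "a \<bullet> b" "b \<bullet> b"] assms(1,2) \<rho>2 pos
      by (simp add: power_divide power_mult_distrib)
  qed
  moreover have "sqrt (2 * pi * \<sigma>\<^sup>2) * sqrt (2 * pi * \<tau>\<^sup>2) =
      sqrt (2 * pi * \<rho>\<^sup>2) * sqrt (2 * pi * (\<sigma> * \<tau> / \<rho>)\<^sup>2)"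
    using pos by (simp add: real_sqrt_mult[symmetric] power_divide power_mult_distrib)
  moreover have "mvn_density s u v * mvn_density t p q =
      exp (- ((norm (v - u))\<^sup>2 / (2 * s\<^sup>2) + (norm (q - p))\<^sup>2 / (2 * t\<^sup>2))) /
      (sqrt (2 * pi * s\<^sup>2) * sqrt (2 * pi * t\<^sup>2)) ^ DIM('a)" for s t and u v p q :: 'a
    by (simp only: mvn_density_def power_mult_distrib times_divide_times_eq mult_exp_exp
        minus_add_distrib minus_divide_left)
  moreover have "x - \<mu> = a - b" "\<mu> - (c + (\<tau>\<^sup>2 / \<rho>\<^sup>2) *\<^sub>R (x - c)) = b - (\<tau>\<^sup>2 / \<rho>\<^sup>2) *\<^sub>R a"
    by (simp_all add: a_def b_def)
  ultimately show ?thesis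
    by (simp only: a_def[symmetric] b_def[symmetric])
qed

lemma nn_integral_mvn_density_mult:
  fixes c x :: "'a::euclidean_space"
  assumes "\<sigma> > 0" "\<tau> > 0"
  shows "(\<integral>\<^sup>+ \<mu>. ennreal (mvn_density \<sigma> \<mu> x) * ennreal (mvn_density \<tau> c \<mu>) \<partial>lborel) =
    ennreal (mvn_density (sqrt (\<sigma>\<^sup>2 + \<tau>\<^sup>2)) c x)"
proof -
  have "sqrt (\<sigma>\<^sup>2 + \<tau>\<^sup>2) > 0"
    using assms by (simp add: add_pos_pos)
  then show ?thesis
    using assms
    by (simp add: ennreal_mult[symmetric] mvn_density_mult)
       (simp add: ennreal_mult nn_integral_cmult nn_integral_mvn_density)
qed

text \<open>Doubling \<sigma> leaves room in the exponent to absorb a polynomial factor and any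
  bounded change of centre. The bound is uniform in \<open>y\<close> near \<open>x0\<close>, as
  differentiation under the integral needs, and \<open>z\<close> is free so that it can later be a
  point where the prior is finite.\<close>

lemma mvn_density_dominated:
  fixes x0 z :: "'a::euclidean_space"
  assumes "\<sigma> > 0"
  obtains K where "K \<ge> 0" "\<And>y \<mu>. norm (y - x0) \<le> 1 \<Longrightarrow>
    (1 + norm \<mu>) ^ k * mvn_density \<sigma> y \<mu> \<le> K * mvn_density (2 * \<sigma>) z \<mu>"
proof -
  define R where "R = norm (x0 - z) + 1"
  define c where "c = 1 + norm z"
  \<comment> \<open>\<open>fact k * exp (c + v)\<close> bounds the polynomial through one term of
    the exponential series. Of the available \<open>v^2 / (4 \<sigma>^2)\<close>, one half absorbs
    \<open>v\<close> at the price \<open>2 \<sigma>^2\<close> and the other is the exponent of the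
    wide Gaussian; \<open>R^2 / (2 \<sigma>^2)\<close> pays for the shift and the power of 2 for the
    normalising constants.\<close>
  define K where "K = fact k * exp (c + 2 * \<sigma>\<^sup>2 + R\<^sup>2 / (2 * \<sigma>\<^sup>2)) * 2 ^ DIM('a)"
  have "(1 + norm \<mu>) ^ k * mvn_density \<sigma> y \<mu> \<le> K * mvn_density (2 * \<sigma>) z \<mu>"
    if "norm (y - x0) \<le> 1" for y \<mu>
  proof -
    define v where "v = norm (\<mu> - z)"
    define r where "r = norm (\<mu> - y)"
    have "v \<le> norm (\<mu> - y) + norm (y - x0) + norm (x0 - z)"
      unfolding v_def by (smt (verit) norm_triangle_sub norm_diff_triangle_le)
    then have vr: "v \<le> r + R"
      using that by (simp add: r_def R_def)
    have v0: "v \<ge> 0" "r \<ge> 0" "R \<ge> 0"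
      by (simp_all add: v_def r_def R_def)
    have "v\<^sup>2 \<le> (r + R)\<^sup>2"
      using vr v0 by (intro power_mono) auto
    also have "\<dots> \<le> 2 * r\<^sup>2 + 2 * R\<^sup>2"
      using zero_le_power2[of "r - R"] by (simp add: power2_eq_square algebra_simps)
    finally have rR: "v\<^sup>2 / 2 \<le> r\<^sup>2 + R\<^sup>2"
      by simp
    have cv: "1 + norm \<mu> \<le> c + v"
      using norm_triangle_sub[of \<mu> z] by (simp add: c_def v_def)
    have c0: "c \<ge> 0" by (simp add: c_def)
    have "(1 + norm \<mu>) ^ k \<le> (c + v) ^ k"
      using cv by (intro power_mono) auto
    also have "\<dots> \<le> fact k * exp (c + v)"
    proof -
      have "(c + v) ^ k /\<^sub>R fact k \<le> exp (c + v)"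
        unfolding exp_def using c0 v0
        by (intro sum_le_suminf[of _ "{k}", simplified] summable_exp_generic) auto
      then show ?thesis by (simp add: field_simps)
    qed
    finally have A: "(1 + norm \<mu>) ^ k \<le> fact k * exp (c + v)" .
    have "v \<le> v\<^sup>2 / (8 * \<sigma>\<^sup>2) + 2 * \<sigma>\<^sup>2"
    proof -
      have "0 \<le> (v - 4 * \<sigma>\<^sup>2)\<^sup>2" by simp
      then have "8 * \<sigma>\<^sup>2 * v \<le> v\<^sup>2 + 2 * \<sigma>\<^sup>2 * (8 * \<sigma>\<^sup>2)"
        by (simp add: power2_eq_square algebra_simps)
      then show ?thesis using assms by (simp add: field_simps)
    qed
    moreover have "- r\<^sup>2 / (2 * \<sigma>\<^sup>2) \<le> R\<^sup>2 / (2 * \<sigma>\<^sup>2) - v\<^sup>2 / (4 * \<sigma>\<^sup>2)"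
    proof -
      have "v\<^sup>2 / 2 / (2 * \<sigma>\<^sup>2) \<le> (r\<^sup>2 + R\<^sup>2) / (2 * \<sigma>\<^sup>2)"
        using rR assms by (intro divide_right_mono) auto
      then show ?thesis by (simp add: add_divide_distrib)
    qed
    moreover have "v\<^sup>2 / (4 * \<sigma>\<^sup>2) = v\<^sup>2 / (8 * \<sigma>\<^sup>2) + v\<^sup>2 / (8 * \<sigma>\<^sup>2)"
      by simp
    ultimately have "c + v - r\<^sup>2 / (2 * \<sigma>\<^sup>2) \<le>
        c + 2 * \<sigma>\<^sup>2 + R\<^sup>2 / (2 * \<sigma>\<^sup>2) - v\<^sup>2 / (8 * \<sigma>\<^sup>2)"
      by linarith
    then have B: "exp (c + v) * exp (- r\<^sup>2 / (2 * \<sigma>\<^sup>2)) \<le>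
        exp (c + 2 * \<sigma>\<^sup>2 + R\<^sup>2 / (2 * \<sigma>\<^sup>2)) * exp (- v\<^sup>2 / (8 * \<sigma>\<^sup>2))"
      by (simp add: mult_exp_exp)
    let ?q = "sqrt (2 * pi * \<sigma>\<^sup>2) ^ DIM('a)"
    have q: "sqrt (2 * pi * (2 * \<sigma>)\<^sup>2) ^ DIM('a) = 2 ^ DIM('a) * ?q" "?q > 0"
    proof -
      have "2 * pi * (2 * \<sigma>)\<^sup>2 = 2\<^sup>2 * (2 * pi * \<sigma>\<^sup>2)"
        by (simp add: power_mult_distrib)
      then have "sqrt (2 * pi * (2 * \<sigma>)\<^sup>2) = 2 * sqrt (2 * pi * \<sigma>\<^sup>2)"
        by (simp only: real_sqrt_mult[of "2\<^sup>2"] real_sqrt_abs)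
      then show "sqrt (2 * pi * (2 * \<sigma>)\<^sup>2) ^ DIM('a) = 2 ^ DIM('a) * ?q"
        by (simp only: power_mult_distrib)
    qed (use assms in simp)
    have "(1 + norm \<mu>) ^ k * mvn_density \<sigma> y \<mu> = (1 + norm \<mu>) ^ k * exp (- r\<^sup>2 / (2 * \<sigma>\<^sup>2)) / ?q"
      by (simp add: mvn_density_def r_def)
    also have "\<dots> \<le> fact k * exp (c + v) * exp (- r\<^sup>2 / (2 * \<sigma>\<^sup>2)) / ?q"
      using q by (intro divide_right_mono mult_right_mono A) auto
    also have "\<dots> \<le> fact k * (exp (c + 2 * \<sigma>\<^sup>2 + R\<^sup>2 / (2 * \<sigma>\<^sup>2)) * exp (- v\<^sup>2 / (8 * \<sigma>\<^sup>2))) / ?q"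
      unfolding mult.assoc using q B by (intro divide_right_mono mult_left_mono) auto
    also have "\<dots> = K * mvn_density (2 * \<sigma>) z \<mu>"
      using q(2) unfolding mvn_density_def q(1) K_def v_def by (simp add: power_mult_distrib)
    finally show ?thesis .
  qed
  moreover have "K \<ge> 0" by (simp add: K_def)
  ultimately show thesis using that by blast
qed

section \<open>Differentiation under the integral sign and Stein's identity\<close>

text \<open>Dominated convergence along sequences of difference quotients; the mean value inequality
  on the interval turns the bound on \<open>f'\<close> into a bound on the quotients.\<close>

lemma has_real_derivative_integral:
  fixes f f' :: "real \<Rightarrow> 'b \<Rightarrow> real"
  assumes "e > 0"
    and deriv: "\<And>t x. \<bar>t - t0\<bar> < e \<Longrightarrow> x \<in> space M \<Longrightarrow>
      ((\<lambda>t. f t x) has_real_derivative f' t x) (at t)"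
    and bound: "\<And>t x. \<bar>t - t0\<bar> < e \<Longrightarrow> x \<in> space M \<Longrightarrow> \<bar>f' t x\<bar> \<le> g x"
    and g: "integrable M g"
    and f: "\<And>t. \<bar>t - t0\<bar> < e \<Longrightarrow> integrable M (f t)"
    and f' [measurable]: "f' t0 \<in> borel_measurable M"
  shows "((\<lambda>t. \<integral>x. f t x \<partial>M) has_real_derivative (\<integral>x. f' t0 x \<partial>M)) (at t0)"
proof -
  let ?S = "{-e<..<e}"
  have "((\<lambda>h. ((\<integral>x. f (t0 + h) x \<partial>M) - (\<integral>x. f t0 x \<partial>M)) / h) \<longlongrightarrow> (\<integral>x. f' t0 x \<partial>M))
      (at 0 within ?S)"
    unfolding tendsto_at_iff_sequentially comp_def
  proof (intro allI impI)
    fix X :: "nat \<Rightarrow> real"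
    assume X: "\<forall>i. X i \<in> ?S - {0}" "X \<longlonglongrightarrow> 0"
    have Xe: "\<bar>X n\<bar> < e" "X n \<noteq> 0" for n
      using X(1)[rule_format, of n] by auto
    have [measurable]: "f (t0 + X n) \<in> borel_measurable M" "f t0 \<in> borel_measurable M" for n
      using f[of "t0 + X n"] f[of t0] Xe \<open>e > 0\<close> by auto
    have "(\<lambda>n. \<integral>x. (f (t0 + X n) x - f t0 x) / X n \<partial>M) \<longlonglongrightarrow> (\<integral>x. f' t0 x \<partial>M)"
    proof (rule integral_dominated_convergence[where w = g])
      show "AE x in M. (\<lambda>n. (f (t0 + X n) x - f t0 x) / X n) \<longlonglongrightarrow> f' t0 x"
      proof (rule AE_I2)
        fix x assume "x \<in> space M"
        then have "((\<lambda>h. (f (t0 + h) x - f t0 x) / h) \<longlongrightarrow> f' t0 x) (at 0)"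
          using deriv[of t0 x] \<open>e > 0\<close> by (simp add: DERIV_def)
        then show "(\<lambda>n. (f (t0 + X n) x - f t0 x) / X n) \<longlonglongrightarrow> f' t0 x"
          using X Xe by (force simp: tendsto_at_iff_sequentially comp_def)
      qed
      show "AE x in M. norm ((f (t0 + X n) x - f t0 x) / X n) \<le> g x" for n
      proof (rule AE_I2)
        fix x assume x: "x \<in> space M"
        have "norm (f (t0 + X n) x - f t0 x) \<le> g x * norm (t0 + X n - t0)"
        proof (rule field_differentiable_bound[where S = "{t. \<bar>t - t0\<bar> < e}" and f' = "\<lambda>t. f' t x"])
          have "{t. \<bar>t - t0\<bar> < e} = ball t0 e"
            by (auto simp: dist_real_def)
          then show "convex {t. \<bar>t - t0\<bar> < e}" by simp
        qed (use deriv[OF _ x] bound[OF _ x] Xe \<open>e > 0\<close> in \<open>auto intro: has_field_derivative_at_within\<close>)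
        then show "norm ((f (t0 + X n) x - f t0 x) / X n) \<le> g x"
          using Xe[of n] by (simp add: field_simps)
      qed
    qed (use g in auto)
    then show "(\<lambda>n. ((\<integral>x. f (t0 + X n) x \<partial>M) - (\<integral>x. f t0 x \<partial>M)) / X n) \<longlonglongrightarrow> (\<integral>x. f' t0 x \<partial>M)"
      using f[of "t0 + X _"] f[of t0] Xe \<open>e > 0\<close> by (simp add: Bochner_Integration.integral_diff)
  qed
  moreover have "at 0 within ?S = at 0"
    using \<open>e > 0\<close> by (intro at_within_open) auto
  ultimately show ?thesis
    by (simp only: DERIV_def)
qed

lemma mvn_density_has_derivative:
  fixes x \<mu> b :: "'a::euclidean_space"
  assumes "\<sigma> > 0" "norm b = 1"
  shows "((\<lambda>t. mvn_density \<sigma> (x + t *\<^sub>R b) \<mu>) has_real_derivative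
    ((\<mu> - (x + t *\<^sub>R b)) \<bullet> b) / \<sigma>\<^sup>2 * mvn_density \<sigma> (x + t *\<^sub>R b) \<mu>) (at t)"
proof -
  have bb: "b \<bullet> b = 1"
    using assms(2) by (simp add: norm_eq_1)
  have eq: "(norm (\<mu> - (x + t *\<^sub>R b)))\<^sup>2 = (norm (\<mu> - x))\<^sup>2 - 2 * t * ((\<mu> - x) \<bullet> b) + t\<^sup>2" for t
    unfolding power2_norm_eq_inner
    by (simp add: inner_diff_left inner_diff_right inner_add_left inner_add_right bb
        inner_commute power2_eq_square algebra_simps)
  have "((\<lambda>t. exp (- (n - 2 * t * k + t\<^sup>2) / (2 * \<sigma>\<^sup>2)) / q) has_real_derivative
      (k - t) / \<sigma>\<^sup>2 * (exp (- (n - 2 * t * k + t\<^sup>2) / (2 * \<sigma>\<^sup>2)) / q)) (at t)" for n k q t :: real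
  proof -
    have "((\<lambda>t. - (n - 2 * t * k + t\<^sup>2) / (2 * \<sigma>\<^sup>2)) has_real_derivative (k - t) / \<sigma>\<^sup>2) (at t)"
      using assms(1) by (auto intro!: derivative_eq_intros simp: field_simps)
    from DERIV_cdivide[OF DERIV_fun_exp[OF this], of q] show ?thesis
      by (simp add: mult.commute)
  qed
  moreover have "(\<mu> - (x + t *\<^sub>R b)) \<bullet> b = (\<mu> - x) \<bullet> b - t"
    by (simp add: inner_diff_left inner_add_left bb)
  ultimately show ?thesis
    unfolding mvn_density_def eq by simp
qed

text \<open>No measurability is assumed: a non-measurable \<open>f\<close> and its translate both
  have the default integral 0.\<close>

lemma lborel_integral_translate:
  fixes f :: "'a::euclidean_space \<Rightarrow> real"
  shows "(\<integral>x. f (x + c) \<partial>lborel) = (\<integral>x. f x \<partial>lborel)"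
proof (cases "f \<in> borel_measurable borel")
  case True
  then show ?thesis
    by (subst (2) lborel_distr_plus[of c, symmetric]) (simp add: integral_distr add.commute)
next
  case False
  then have "\<not> integrable lborel f" by auto
  moreover have "\<not> integrable lborel (\<lambda>x. f (x + c))"
  proof
    assume "integrable lborel (\<lambda>x. f (x + c))"
    then have "(\<lambda>x. f (x + c)) \<in> borel_measurable borel" by auto
    then have "(\<lambda>x. f ((x - c) + c)) \<in> borel_measurable borel"
      by (rule measurable_compose[rotated]) measurable
    with False show False by simp
  qed
  ultimately show ?thesis
    by (simp add: not_integrable_integral_eq)
qed

section \<open>Stein's identity and the first two Gaussian moments\<close>

lemma integrable_mvn_density_moment:
  fixes f :: "'a::euclidean_space \<Rightarrow> real"
  assumes "\<sigma> > 0" and [measurable]: "f \<in> borel_measurable borel"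
    and f: "\<And>x. \<bar>f x\<bar> \<le> A * (1 + norm x) ^ k"
  shows "integrable lborel (\<lambda>x. f x * mvn_density \<sigma> \<theta> x)"
proof -
  obtain K where K: "K \<ge> 0" "\<And>y \<mu>. norm (y - \<theta>) \<le> 1 \<Longrightarrow>
    (1 + norm \<mu>) ^ k * mvn_density \<sigma> y \<mu> \<le> K * mvn_density (2 * \<sigma>) \<theta> \<mu>"
    using mvn_density_dominated[OF assms(1), of \<theta> k \<theta>] by blast
  have A: "A \<ge> 0" using f[of 0] by simp
  show ?thesis
  proof (rule Bochner_Integration.integrable_bound)
    show "integrable lborel (\<lambda>x. A * (K * mvn_density (2 * \<sigma>) \<theta> x))"
      using assms(1) by simp
    show "AE x in lborel. norm (f x * mvn_density \<sigma> \<theta> x) \<le> norm (A * (K * mvn_density (2 * \<sigma>) \<theta> x))"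
    proof (rule AE_I2)
      fix x
      have "norm (f x * mvn_density \<sigma> \<theta> x) \<le> A * (1 + norm x) ^ k * mvn_density \<sigma> \<theta> x"
        using f[of x] by (simp add: abs_mult mult_right_mono)
      also have "\<dots> \<le> A * (K * mvn_density (2 * \<sigma>) \<theta> x)"
        unfolding mult.assoc using A K(2)[of \<theta> x] by (intro mult_left_mono) auto
      finally show "norm (f x * mvn_density \<sigma> \<theta> x) \<le> norm (A * (K * mvn_density (2 * \<sigma>) \<theta> x))"
        by simp
    qed
  qed measurable
qed

text \<open>The function \<open>t \<mapsto> E f (X + t b)\<close> is differentiated at 0 in two
  ways: with the shift inside \<open>f\<close>, and, after translating the integration variable,
  with the shift in the centre of the Gaussian. Compared with integration by parts, this needs
  neither boundary terms nor continuity of \<open>f'\<close>.\<close>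

lemma stein_identity:
  fixes f f' :: "'a::euclidean_space \<Rightarrow> real"
  assumes "\<sigma> > 0" "norm b = 1"
    and [measurable]: "f \<in> borel_measurable borel" "f' \<in> borel_measurable borel"
    and deriv: "\<And>x. ((\<lambda>t. f (x + t *\<^sub>R b)) has_real_derivative f' x) (at 0)"
    and f': "\<And>x. \<bar>f' x\<bar> \<le> C"
    and f: "\<And>x. \<bar>f x\<bar> \<le> A * (1 + norm x)"
  shows "(\<integral>x. ((x - \<theta>) \<bullet> b) * f x * mvn_density \<sigma> \<theta> x \<partial>lborel) =
    \<sigma>\<^sup>2 * (\<integral>x. f' x * mvn_density \<sigma> \<theta> x \<partial>lborel)"
proof -
  have A: "A \<ge> 0" using f[of 0] by simp
  have ft: "\<bar>f (x + t *\<^sub>R b)\<bar> \<le> A * (1 + \<bar>t\<bar>) * (1 + norm x)" for x t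
  proof -
    have "\<bar>f (x + t *\<^sub>R b)\<bar> \<le> A * (1 + (norm x + \<bar>t\<bar>))"
    proof (rule order_trans[OF f mult_left_mono[OF _ A]])
      show "1 + norm (x + t *\<^sub>R b) \<le> 1 + (norm x + \<bar>t\<bar>)"
        using norm_triangle_ineq[of x "t *\<^sub>R b"] assms(2) by simp
    qed
    also have "\<dots> \<le> A * ((1 + \<bar>t\<bar>) * (1 + norm x))"
      using A by (intro mult_left_mono) (auto simp: algebra_simps)
    finally show ?thesis by (simp add: mult.assoc)
  qed
  have intf: "integrable lborel (\<lambda>x. f (x + t *\<^sub>R b) * mvn_density \<sigma> \<theta> x)" for t
    using integrable_mvn_density_moment[OF assms(1), of "\<lambda>x. f (x + t *\<^sub>R b)" "A * (1 + \<bar>t\<bar>)" 1] ft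
    by simp
  let ?F = "\<lambda>t. \<integral>x. f (x + t *\<^sub>R b) * mvn_density \<sigma> \<theta> x \<partial>lborel"
  have "(?F has_real_derivative (\<integral>x. f' (x + 0 *\<^sub>R b) * mvn_density \<sigma> \<theta> x \<partial>lborel)) (at 0)"
  proof (rule has_real_derivative_integral[where e = 1 and g = "\<lambda>x. C * mvn_density \<sigma> \<theta> x"
        and f' = "\<lambda>t x. f' (x + t *\<^sub>R b) * mvn_density \<sigma> \<theta> x"])
    fix t x
    have "((\<lambda>s. f (x + (t + s) *\<^sub>R b)) has_real_derivative f' (x + t *\<^sub>R b)) (at 0)"
      using deriv[of "x + t *\<^sub>R b"] by (simp add: algebra_simps)
    then have "((\<lambda>t. f (x + t *\<^sub>R b)) has_real_derivative f' (x + t *\<^sub>R b)) (at t)"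
      using DERIV_at_within_shift[of "\<lambda>t. f (x + t *\<^sub>R b)" "f' (x + t *\<^sub>R b)" t 0 UNIV]
      by simp
    then show "((\<lambda>t. f (x + t *\<^sub>R b) * mvn_density \<sigma> \<theta> x) has_real_derivative
        f' (x + t *\<^sub>R b) * mvn_density \<sigma> \<theta> x) (at t)"
      by (rule DERIV_cmult_right)
  qed (use assms(1) f' intf in \<open>auto simp: abs_mult intro!: mult_right_mono\<close>)
  moreover have "(?F has_real_derivative
      (\<integral>x. f x * (((x - (\<theta> + 0 *\<^sub>R b)) \<bullet> b) / \<sigma>\<^sup>2 * mvn_density \<sigma> (\<theta> + 0 *\<^sub>R b) x) \<partial>lborel)) (at 0)"
  proof -
    have F: "?F = (\<lambda>t. \<integral>x. f x * mvn_density \<sigma> (\<theta> + t *\<^sub>R b) x \<partial>lborel)"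
    proof
      fix t
      have "(\<integral>x. f (x + t *\<^sub>R b) * mvn_density \<sigma> (\<theta> + t *\<^sub>R b) (x + t *\<^sub>R b) \<partial>lborel) =
          (\<integral>x. f x * mvn_density \<sigma> (\<theta> + t *\<^sub>R b) x \<partial>lborel)"
        by (rule lborel_integral_translate)
      then show "?F t = (\<integral>x. f x * mvn_density \<sigma> (\<theta> + t *\<^sub>R b) x \<partial>lborel)"
        by (simp add: mvn_density_def)
    qed
    \<comment> \<open>Degree 2: one linear factor is the growth of \<open>f\<close>, the other comes
      from differentiating the Gaussian in its centre.\<close>
    obtain K where K: "K \<ge> 0" "\<And>y \<mu>. norm (y - \<theta>) \<le> 1 \<Longrightarrow>
      (1 + norm \<mu>) ^ 2 * mvn_density \<sigma> y \<mu> \<le> K * mvn_density (2 * \<sigma>) \<theta> \<mu>"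
      using mvn_density_dominated[OF assms(1), of \<theta> 2 \<theta>] by blast
    show ?thesis
      unfolding F
    proof (rule has_real_derivative_integral[where e = 1
          and g = "\<lambda>x. A * (2 + norm \<theta>) / \<sigma>\<^sup>2 * (K * mvn_density (2 * \<sigma>) \<theta> x)"
          and f' = "\<lambda>t x. f x * (((x - (\<theta> + t *\<^sub>R b)) \<bullet> b) / \<sigma>\<^sup>2 * mvn_density \<sigma> (\<theta> + t *\<^sub>R b) x)"])
      fix t :: real and x :: 'a
      assume t: "\<bar>t - 0\<bar> < 1"
      have "\<bar>(x - (\<theta> + t *\<^sub>R b)) \<bullet> b\<bar> \<le> norm (x - (\<theta> + t *\<^sub>R b))"
        using Cauchy_Schwarz_ineq2[of "x - (\<theta> + t *\<^sub>R b)" b] assms(2) by simp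
      also have "\<dots> \<le> norm x + (norm \<theta> + 1)"
        using t norm_triangle_ineq4[of x "\<theta> + t *\<^sub>R b"] norm_triangle_ineq[of \<theta> "t *\<^sub>R b"] assms(2)
        by simp
      also have "\<dots> \<le> (2 + norm \<theta>) * (1 + norm x)"
        by (simp add: algebra_simps)
      finally have 1: "\<bar>(x - (\<theta> + t *\<^sub>R b)) \<bullet> b\<bar> \<le> (2 + norm \<theta>) * (1 + norm x)" .
      have "\<bar>f x * (((x - (\<theta> + t *\<^sub>R b)) \<bullet> b) / \<sigma>\<^sup>2 * mvn_density \<sigma> (\<theta> + t *\<^sub>R b) x)\<bar> \<le>
          A * (1 + norm x) * (((2 + norm \<theta>) * (1 + norm x)) / \<sigma>\<^sup>2 * mvn_density \<sigma> (\<theta> + t *\<^sub>R b) x)"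
        unfolding abs_mult using A 1
        by (intro mult_mono f) (auto simp: abs_mult intro!: mult_right_mono divide_right_mono)
      also have "\<dots> = A * (2 + norm \<theta>) / \<sigma>\<^sup>2 * ((1 + norm x) ^ 2 * mvn_density \<sigma> (\<theta> + t *\<^sub>R b) x)"
        by (simp add: power2_eq_square)
      also have "\<dots> \<le> A * (2 + norm \<theta>) / \<sigma>\<^sup>2 * (K * mvn_density (2 * \<sigma>) \<theta> x)"
        using A t assms(2) by (intro mult_left_mono K(2)) auto
      finally show "\<bar>f x * (((x - (\<theta> + t *\<^sub>R b)) \<bullet> b) / \<sigma>\<^sup>2 * mvn_density \<sigma> (\<theta> + t *\<^sub>R b) x)\<bar> \<le>
        A * (2 + norm \<theta>) / \<sigma>\<^sup>2 * (K * mvn_density (2 * \<sigma>) \<theta> x)" .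
    next
      fix t :: real
      show "integrable lborel (\<lambda>x. f x * mvn_density \<sigma> (\<theta> + t *\<^sub>R b) x)"
        using integrable_mvn_density_moment[OF assms(1), of f A 1] f by simp
    next
      fix t :: real and x :: 'a
      show "((\<lambda>t. f x * mvn_density \<sigma> (\<theta> + t *\<^sub>R b) x) has_real_derivative
          f x * (((x - (\<theta> + t *\<^sub>R b)) \<bullet> b) / \<sigma>\<^sup>2 * mvn_density \<sigma> (\<theta> + t *\<^sub>R b) x)) (at t)"
        by (intro DERIV_cmult mvn_density_has_derivative assms)
    next
      show "integrable lborel (\<lambda>x. A * (2 + norm \<theta>) / \<sigma>\<^sup>2 * (K * mvn_density (2 * \<sigma>) \<theta> x))"
        using assms(1) by simp
    qed (simp, measurable)
  qed
  ultimately have "(\<integral>x. f' (x + 0 *\<^sub>R b) * mvn_density \<sigma> \<theta> x \<partial>lborel) =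
      (\<integral>x. f x * (((x - (\<theta> + 0 *\<^sub>R b)) \<bullet> b) / \<sigma>\<^sup>2 * mvn_density \<sigma> (\<theta> + 0 *\<^sub>R b) x) \<partial>lborel)"
    by (rule DERIV_unique)
  then have "(\<integral>x. f' x * mvn_density \<sigma> \<theta> x \<partial>lborel) =
      (\<integral>x. f x * (((x - \<theta>) \<bullet> b) / \<sigma>\<^sup>2 * mvn_density \<sigma> \<theta> x) \<partial>lborel)"
    by simp
  also have "\<dots> = (\<integral>x. (((x - \<theta>) \<bullet> b) * f x * mvn_density \<sigma> \<theta> x) / \<sigma>\<^sup>2 \<partial>lborel)"
    by (intro Bochner_Integration.integral_cong) (auto simp: field_simps)
  finally show ?thesis
    using assms(1) by simp
qed

text \<open>Stein's identity for the constant function 1, extended from basis vectors by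
  linearity.\<close>

lemma integral_mvn_density_inner:
  fixes \<theta> c :: "'a::euclidean_space"
  assumes "\<sigma> > 0"
  shows "(\<integral>x. ((x - \<theta>) \<bullet> c) * mvn_density \<sigma> \<theta> x \<partial>lborel) = 0"
proof -
  have 1: "(\<integral>x. ((x - \<theta>) \<bullet> b) * mvn_density \<sigma> \<theta> x \<partial>lborel) = 0" if "b \<in> Basis" for b
    using stein_identity[of \<sigma> b "\<lambda>_. 1" "\<lambda>_. 0" 0 1 \<theta>] assms that by simp
  have int: "integrable lborel (\<lambda>x. (x - \<theta>) \<bullet> b * mvn_density \<sigma> \<theta> x)" if "b \<in> Basis" for b
  proof (rule integrable_mvn_density_moment[OF assms, of _ "1 + norm \<theta>" 1])
    fix x
    have "\<bar>(x - \<theta>) \<bullet> b\<bar> \<le> norm x + norm \<theta>"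
      using Basis_le_norm[OF that, of "x - \<theta>"] norm_triangle_ineq4[of x \<theta>] by linarith
    also have "\<dots> \<le> (1 + norm \<theta>) * (1 + norm x) ^ 1"
      by (simp add: algebra_simps)
    finally show "\<bar>(x - \<theta>) \<bullet> b\<bar> \<le> (1 + norm \<theta>) * (1 + norm x) ^ 1" .
  qed measurable
  have "(\<integral>x. ((x - \<theta>) \<bullet> c) * mvn_density \<sigma> \<theta> x \<partial>lborel) =
      (\<integral>x. (\<Sum>b\<in>Basis. (c \<bullet> b) * (((x - \<theta>) \<bullet> b) * mvn_density \<sigma> \<theta> x)) \<partial>lborel)"
    by (subst euclidean_inner) (simp add: sum_distrib_left sum_distrib_right mult_ac)
  also have "\<dots> = 0"
    by (subst Bochner_Integration.integral_sum) (auto simp: int 1)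
  finally show ?thesis .
qed

lemma norm_diff_sq_le_moment: "(norm (x - c))\<^sup>2 \<le> (1 + norm c)\<^sup>2 * (1 + norm x)\<^sup>2"
proof -
  have "norm (x - c) \<le> norm x + norm c"
    by (rule norm_triangle_ineq4)
  also have "\<dots> \<le> (1 + norm c) * (1 + norm x)"
    by (simp add: algebra_simps)
  finally show ?thesis
    unfolding power_mult_distrib[symmetric] by (intro power_mono) auto
qed

lemma integrable_mvn_density_norm_sq:
  fixes \<theta> c :: "'a::euclidean_space"
  assumes "\<sigma> > 0"
  shows "integrable lborel (\<lambda>x. (norm (x - c))\<^sup>2 * mvn_density \<sigma> \<theta> x)"
  using norm_diff_sq_le_moment
  by (intro integrable_mvn_density_moment[OF assms, of _ "(1 + norm c)\<^sup>2" 2]) auto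

text \<open>Each coordinate contributes \<open>\<sigma>^2\<close> by Stein's identity for
  \<open>f x = (x - \<theta>) . b\<close>, whose derivative is 1.\<close>

lemma integral_mvn_density_norm_sq:
  fixes \<sigma> :: real and \<theta> :: "'a::euclidean_space"
  assumes "\<sigma> > 0"
  shows "(\<integral>x. (norm (x - \<theta>))\<^sup>2 * mvn_density \<sigma> \<theta> x \<partial>lborel) = DIM('a) * \<sigma>\<^sup>2"
proof -
  have 1: "(\<integral>x. ((x - \<theta>) \<bullet> b)\<^sup>2 * mvn_density \<sigma> \<theta> x \<partial>lborel) = \<sigma>\<^sup>2" if "b \<in> Basis" for b
  proof -
    have "(\<integral>x. ((x - \<theta>) \<bullet> b) * ((x - \<theta>) \<bullet> b) * mvn_density \<sigma> \<theta> x \<partial>lborel) =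
        \<sigma>\<^sup>2 * (\<integral>x. 1 * mvn_density \<sigma> \<theta> x \<partial>lborel)"
    proof (rule stein_identity[of \<sigma> b _ _ 1 "1 + norm \<theta>"])
      fix x
      show "((\<lambda>t. (x + t *\<^sub>R b - \<theta>) \<bullet> b) has_real_derivative 1) (at 0)"
        using that by (auto intro!: derivative_eq_intros simp: inner_diff_left inner_add_left)
      have "\<bar>(x - \<theta>) \<bullet> b\<bar> \<le> norm x + norm \<theta>"
        using Basis_le_norm[OF that, of "x - \<theta>"] norm_triangle_ineq4[of x \<theta>] by linarith
      also have "\<dots> \<le> (1 + norm \<theta>) * (1 + norm x)"
        by (simp add: algebra_simps)
      finally show "\<bar>(x - \<theta>) \<bullet> b\<bar> \<le> (1 + norm \<theta>) * (1 + norm x)" .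
    qed (use assms that in auto)
    then show ?thesis using assms by (simp add: power2_eq_square[of "_ \<bullet> _"])
  qed
  have int: "integrable lborel (\<lambda>x. ((x - \<theta>) \<bullet> b)\<^sup>2 * mvn_density \<sigma> \<theta> x)" if "b \<in> Basis" for b
  proof (rule integrable_mvn_density_moment[OF assms, of _ "(1 + norm \<theta>)\<^sup>2" 2])
    fix x
    show "\<bar>((x - \<theta>) \<bullet> b)\<^sup>2\<bar> \<le> (1 + norm \<theta>)\<^sup>2 * (1 + norm x)\<^sup>2"
      using power_mono[OF Basis_le_norm[OF that, of "x - \<theta>"] abs_ge_zero, of 2]
        norm_diff_sq_le_moment[of x \<theta>] by simp
  qed measurable
  have "(\<integral>x. (norm (x - \<theta>))\<^sup>2 * mvn_density \<sigma> \<theta> x \<partial>lborel) =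
      (\<integral>x. (\<Sum>b\<in>Basis. ((x - \<theta>) \<bullet> b)\<^sup>2 * mvn_density \<sigma> \<theta> x) \<partial>lborel)"
    by (simp only: power2_norm_eq_inner euclidean_inner[of "_ - _" "_ - _"] sum_distrib_right
        power2_eq_square[of "_ \<bullet> _"])
  also have "\<dots> = (\<Sum>b\<in>Basis. \<integral>x. ((x - \<theta>) \<bullet> b)\<^sup>2 * mvn_density \<sigma> \<theta> x \<partial>lborel)"
    using int by (rule Bochner_Integration.integral_sum)
  also have "\<dots> = DIM('a) * \<sigma>\<^sup>2"
    by (simp add: 1)
  finally show ?thesis .
qed

section \<open>Gaussian averages of superharmonic functions\<close>

lemma superharmonic_measurable:
  fixes f :: "'a::euclidean_space \<Rightarrow> ennreal"
  assumes "superharmonic f"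
  shows "f \<in> borel_measurable borel"
proof (rule borel_measurableI_greater)
  fix a
  have "open {x. a < f x}"
    using assms by (simp add: superharmonic_def)
  then show "{x \<in> space borel. a < f x} \<in> sets borel"
    by simp
qed

lemma emeasure_lborel_open_pos:
  fixes S :: "'a::euclidean_space set"
  assumes "open S" "S \<noteq> {}"
  shows "emeasure lborel S > 0"
proof (rule ccontr)
  assume "\<not> ?thesis"
  then have "S \<in> null_sets lebesgue"
    using assms(1) by (intro null_sets_completionI) (auto simp: null_sets_def)
  with open_not_negligible[OF assms] show False
    by (simp add: negligible_iff_null_sets)
qed

text \<open>A ball has positive finite measure, so the average may be multiplied out; in this form
  the inequality can be integrated over a family of balls.\<close>

lemma superharmonic_ball:
  fixes f :: "'a::euclidean_space \<Rightarrow> ennreal"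
  assumes "superharmonic f" "r > 0"
  shows "(\<integral>\<^sup>+ y. f y * indicator (ball x r) y \<partial>lborel) \<le> f x * emeasure lborel (ball x r)"
proof -
  note [measurable] = superharmonic_measurable[OF assms(1)]
  have pos: "emeasure lborel (ball x r) > 0"
    using assms(2) by (intro emeasure_lborel_open_pos) auto
  have fin: "emeasure lborel (ball x r) < \<infinity>"
    by (intro emeasure_bounded_finite) simp
  let ?I = "\<integral>\<^sup>+ y. f y * indicator (ball x r) y \<partial>lborel"
  have "?I / emeasure lborel (ball x r) \<le> f x"
    using assms by (simp add: superharmonic_def nn_integral_uniform_measure)
  then have "?I / emeasure lborel (ball x r) * emeasure lborel (ball x r) \<le>
      f x * emeasure lborel (ball x r)"
    by (rule mult_right_mono) simp
  then show ?thesis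
    using pos fin by (simp add: ennreal_divide_times)
qed

lemma mvn_density_superlevel:
  fixes x :: "'a::euclidean_space"
  assumes "\<sigma> > 0" "u > 0"
  shows "{\<mu>. u < mvn_density \<sigma> x \<mu>} = {} \<or> (\<exists>r>0. {\<mu>. u < mvn_density \<sigma> x \<mu>} = ball x r)"
proof -
  define q where "q = sqrt (2 * pi * \<sigma>\<^sup>2) ^ DIM('a)"
  \<comment> \<open>The squared distance from \<open>x\<close> at which the density falls to
    \<open>u\<close>; it is not positive exactly when \<open>u\<close> reaches or exceeds the peak
    value.\<close>
  define a where "a = - (2 * \<sigma>\<^sup>2 * ln (u * q))"
  have q: "q > 0" using assms by (simp add: q_def)
  have iff: "u < mvn_density \<sigma> x \<mu> \<longleftrightarrow> (norm (\<mu> - x))\<^sup>2 < a" for \<mu>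
  proof -
    have "u < mvn_density \<sigma> x \<mu> \<longleftrightarrow> u * q < exp (- (norm (\<mu> - x))\<^sup>2 / (2 * \<sigma>\<^sup>2))"
      using q by (simp add: mvn_density_def q_def[symmetric] pos_less_divide_eq)
    also have "\<dots> \<longleftrightarrow> ln (u * q) < - (norm (\<mu> - x))\<^sup>2 / (2 * \<sigma>\<^sup>2)"
      using q assms(2) by (metis exp_less_cancel_iff exp_ln mult_pos_pos)
    also have "\<dots> \<longleftrightarrow> (norm (\<mu> - x))\<^sup>2 < a"
      using assms(1) by (auto simp: a_def field_simps)
    finally show ?thesis .
  qed
  show ?thesis
  proof (cases "a > 0")
    case True
    have "(norm (\<mu> - x))\<^sup>2 < a \<longleftrightarrow> dist x \<mu> < sqrt a" for \<mu>
      using real_sqrt_less_iff[of "(norm (\<mu> - x))\<^sup>2" a]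
      by (simp add: dist_norm norm_minus_commute)
    then have "{\<mu>. u < mvn_density \<sigma> x \<mu>} = ball x (sqrt a)"
      by (simp only: iff ball_def)
    moreover have "sqrt a > 0" using True by simp
    ultimately show ?thesis by blast
  next
    case False
    then have "\<not> (norm (\<mu> - x))\<^sup>2 < a" for \<mu>
      by (smt (verit) zero_le_power2)
    then show ?thesis
      unfolding iff by simp
  qed
qed

text \<open>The superlevel sets of the Gaussian are balls, so the Gaussian is a mixture of uniform
  distributions on balls.\<close>

lemma superharmonic_mvn_density:
  fixes f :: "'a::euclidean_space \<Rightarrow> ennreal"
  assumes "superharmonic f" "\<sigma> > 0"
  shows "(\<integral>\<^sup>+ \<mu>. ennreal (mvn_density \<sigma> x \<mu>) * f \<mu> \<partial>lborel) \<le> f x"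
proof -
  note [measurable] = superharmonic_measurable[OF assms(1)]
  let ?S = "\<lambda>u. {\<mu>. u < mvn_density \<sigma> x \<mu>}"
  let ?I = "\<lambda>u \<mu>. indicator {0<..} u * (indicator (?S u) \<mu> :: ennreal)"
  have [measurable]: "(\<lambda>(u, \<mu>). ?I u \<mu>) \<in> borel_measurable (borel \<Otimes>\<^sub>M borel)"
    unfolding indicator_def by measurable
  have layer: "ennreal (mvn_density \<sigma> x \<mu>) = (\<integral>\<^sup>+ u. ?I u \<mu> \<partial>lborel)" for \<mu>
  proof -
    have "(\<integral>\<^sup>+ u. ?I u \<mu> \<partial>lborel) = (\<integral>\<^sup>+ u. indicator {0<..<mvn_density \<sigma> x \<mu>} u \<partial>lborel)"
      by (intro nn_integral_cong) (auto simp: indicator_def)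
    then show ?thesis by simp
  qed
  have mean: "(\<integral>\<^sup>+ \<mu>. ?I u \<mu> * f \<mu> \<partial>lborel) \<le> f x * (\<integral>\<^sup>+ \<mu>. ?I u \<mu> \<partial>lborel)" for u
  proof (cases "u > 0 \<and> ?S u \<noteq> {}")
    case True
    then obtain r where r: "r > 0" "?S u = ball x r"
      using mvn_density_superlevel[of \<sigma> u x] assms(2) by auto
    show ?thesis
      using superharmonic_ball[OF assms(1) r(1), of x] True by (simp add: r(2) mult.commute)
  next
    case False
    then have "?I u \<mu> = 0" for \<mu>
      by (auto simp: indicator_def)
    then show ?thesis by (simp only: mult_zero_left nn_integral_const) simp
  qed
  have "(\<integral>\<^sup>+ \<mu>. ennreal (mvn_density \<sigma> x \<mu>) * f \<mu> \<partial>lborel) =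
      (\<integral>\<^sup>+ \<mu>. (\<integral>\<^sup>+ u. ?I u \<mu> * f \<mu> \<partial>lborel) \<partial>lborel)"
    unfolding layer by (intro nn_integral_cong nn_integral_multc[symmetric]) measurable
  also have "\<dots> = (\<integral>\<^sup>+ u. (\<integral>\<^sup>+ \<mu>. ?I u \<mu> * f \<mu> \<partial>lborel) \<partial>lborel)"
    by (rule lborel_pair.Fubini') measurable
  also have "\<dots> \<le> (\<integral>\<^sup>+ u. f x * (\<integral>\<^sup>+ \<mu>. ?I u \<mu> \<partial>lborel) \<partial>lborel)"
    by (intro nn_integral_mono mean)
  also have "\<dots> = f x * (\<integral>\<^sup>+ u. (\<integral>\<^sup>+ \<mu>. ?I u \<mu> \<partial>lborel) \<partial>lborel)"
    by (rule nn_integral_cmult) measurable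
  also have "(\<integral>\<^sup>+ u. (\<integral>\<^sup>+ \<mu>. ?I u \<mu> \<partial>lborel) \<partial>lborel) = (\<integral>\<^sup>+ \<mu>. (\<integral>\<^sup>+ u. ?I u \<mu> \<partial>lborel) \<partial>lborel)"
    by (rule lborel_pair.Fubini'[symmetric]) measurable
  also have "\<dots> = 1"
    unfolding layer[symmetric] by (rule nn_integral_mvn_density[OF assms(2)])
  finally show ?thesis by simp
qed

text \<open>Smoothing with \<tau> is smoothing with \<rho> followed by smoothing with \<sigma>,
  where \<open>\<rho>^2 = \<tau>^2 - \<sigma>^2\<close>. The inner smoothing lies below
  \<open>f\<close> by the Gaussian mean value inequality.\<close>

lemma superharmonic_mvn_density_antimono:
  fixes f :: "'a::euclidean_space \<Rightarrow> ennreal"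
  assumes "superharmonic f" "0 < \<sigma>" "\<sigma> < \<tau>"
  shows "(\<integral>\<^sup>+ \<mu>. ennreal (mvn_density \<tau> x \<mu>) * f \<mu> \<partial>lborel) \<le>
    (\<integral>\<^sup>+ \<mu>. ennreal (mvn_density \<sigma> x \<mu>) * f \<mu> \<partial>lborel)"
proof -
  note [measurable] = superharmonic_measurable[OF assms(1)]
  define \<rho> where "\<rho> = sqrt (\<tau>\<^sup>2 - \<sigma>\<^sup>2)"
  have "\<sigma>\<^sup>2 < \<tau>\<^sup>2"
    using assms by (intro power_strict_mono) auto
  then have \<rho>: "\<rho> > 0" "sqrt (\<sigma>\<^sup>2 + \<rho>\<^sup>2) = \<tau>"
    using assms by (simp_all add: \<rho>_def)
  have "(\<integral>\<^sup>+ \<mu>. ennreal (mvn_density \<tau> x \<mu>) * f \<mu> \<partial>lborel) =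
      (\<integral>\<^sup>+ \<mu>. (\<integral>\<^sup>+ \<nu>. ennreal (mvn_density \<sigma> \<nu> x) * ennreal (mvn_density \<rho> \<mu> \<nu>) * f \<mu> \<partial>lborel) \<partial>lborel)"
    using nn_integral_mvn_density_mult[OF assms(2) \<rho>(1), where 'a = 'a] \<rho>(2)
    by (simp add: nn_integral_multc mvn_density_commute[of \<tau> x])
  also have "\<dots> = (\<integral>\<^sup>+ \<nu>. (\<integral>\<^sup>+ \<mu>. ennreal (mvn_density \<sigma> \<nu> x) * ennreal (mvn_density \<rho> \<mu> \<nu>) * f \<mu> \<partial>lborel) \<partial>lborel)"
    by (rule lborel_pair.Fubini') measurable
  also have "\<dots> = (\<integral>\<^sup>+ \<nu>. ennreal (mvn_density \<sigma> x \<nu>) * (\<integral>\<^sup>+ \<mu>. ennreal (mvn_density \<rho> \<nu> \<mu>) * f \<mu> \<partial>lborel) \<partial>lborel)"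
    by (intro nn_integral_cong)
       (simp add: nn_integral_cmult mult.assoc mvn_density_commute[of \<sigma> _ x] mvn_density_commute[of \<rho> _ "_::'a"])
  also have "\<dots> \<le> (\<integral>\<^sup>+ \<nu>. ennreal (mvn_density \<sigma> x \<nu>) * f \<nu> \<partial>lborel)"
    by (intro nn_integral_mono mult_left_mono superharmonic_mvn_density assms \<rho>) simp
  finally show ?thesis .
qed

text \<open>The ratio of the two densities is \<open>r^(-d)\<close> times the exponential of
  \<open>(1 - 1 / r^2) / (2 \<sigma>^2)\<close> times the squared distance. Its linear lower bound
  makes the second moment for \<sigma> visible in the average for
  \<open>r * \<sigma>\<close>.\<close>

lemma mvn_density_scale_ge:
  fixes x \<mu> :: "'a::euclidean_space"
  assumes "\<sigma> > 0" "r > 1"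
  shows "(1 + (1 - 1 / r\<^sup>2) / (2 * \<sigma>\<^sup>2) * (norm (\<mu> - x))\<^sup>2) * mvn_density \<sigma> x \<mu> / r ^ DIM('a) \<le>
    mvn_density (r * \<sigma>) x \<mu>"
proof -
  define n where "n = (norm (\<mu> - x))\<^sup>2"
  let ?q = "sqrt (2 * pi * \<sigma>\<^sup>2) ^ DIM('a)"
  have "2 * pi * (r * \<sigma>)\<^sup>2 = r\<^sup>2 * (2 * pi * \<sigma>\<^sup>2)"
    by (simp add: power_mult_distrib)
  then have "sqrt (2 * pi * (r * \<sigma>)\<^sup>2) = r * sqrt (2 * pi * \<sigma>\<^sup>2)"
    using assms(2) by (simp only: real_sqrt_mult[of "r\<^sup>2"] real_sqrt_abs)
  then have q: "sqrt (2 * pi * (r * \<sigma>)\<^sup>2) ^ DIM('a) = ?q * r ^ DIM('a)"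
    by (simp only: power_mult_distrib mult.commute)
  have "(1 + (1 - 1 / r\<^sup>2) / (2 * \<sigma>\<^sup>2) * n) * exp (- n / (2 * \<sigma>\<^sup>2)) \<le>
      exp ((1 - 1 / r\<^sup>2) / (2 * \<sigma>\<^sup>2) * n) * exp (- n / (2 * \<sigma>\<^sup>2))"
    by (intro mult_right_mono exp_ge_add_one_self) auto
  also have "\<dots> = exp (- n / (2 * (r * \<sigma>)\<^sup>2))"
  proof -
    have "(1 - 1 / r\<^sup>2) / (2 * \<sigma>\<^sup>2) * n + - n / (2 * \<sigma>\<^sup>2) = - n / (2 * (r * \<sigma>)\<^sup>2)"
      using assms by (simp add: field_simps)
    then show ?thesis by (simp only: mult_exp_exp)
  qed
  finally have "(1 + (1 - 1 / r\<^sup>2) / (2 * \<sigma>\<^sup>2) * n) * exp (- n / (2 * \<sigma>\<^sup>2)) / (?q * r ^ DIM('a)) \<le>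
      exp (- n / (2 * (r * \<sigma>)\<^sup>2)) / (?q * r ^ DIM('a))"
    using assms by (intro divide_right_mono) auto
  then show ?thesis
    unfolding mvn_density_def q n_def by simp
qed

text \<open>This is the inequality \<open>\<Delta>m \<le> 0\<close> for the Gaussian average \<open>m\<close> of \<open>f\<close>: it expresses that \<open>m\<close>
  decreases with the variance, and convexity of the exponential replaces the derivative.\<close>

lemma superharmonic_second_moment:
  fixes \<sigma> :: real and f :: "'a::euclidean_space \<Rightarrow> ennreal"
  assumes "superharmonic f" "\<sigma> > 0"
  shows "(\<integral>\<^sup>+ \<mu>. ennreal ((norm (\<mu> - x))\<^sup>2 * mvn_density \<sigma> x \<mu>) * f \<mu> \<partial>lborel) \<le>
    ennreal (DIM('a) * \<sigma>\<^sup>2) * (\<integral>\<^sup>+ \<mu>. ennreal (mvn_density \<sigma> x \<mu>) * f \<mu> \<partial>lborel)"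
    (is "?S \<le> _ * ?M")
proof (cases "?M = \<infinity>")
  case True
  then show ?thesis using assms(2) by (simp add: ennreal_mult_top)
next
  case False
  note [measurable] = superharmonic_measurable[OF assms(1)]
  define d where "d = DIM('a)"
  obtain m where m: "?M = ennreal m" "m \<ge> 0"
    using False by (cases ?M) auto
  \<comment> \<open>The previous bound integrated against \<open>f\<close>: the average for
    \<open>r * \<sigma>\<close> dominates the left side and, by monotonicity in the variance, is at
    most the average for \<sigma>.\<close>
  have ineq: "ennreal (1 / r ^ d) * ?M + ennreal ((1 - 1 / r\<^sup>2) / (2 * \<sigma>\<^sup>2) / r ^ d) * ?S \<le> ?M"
    if r: "r > 1" for r
  proof -
    have k: "0 \<le> 1 - 1 / r\<^sup>2" using r by simp
    have "ennreal (1 / r ^ d) * ?M + ennreal ((1 - 1 / r\<^sup>2) / (2 * \<sigma>\<^sup>2) / r ^ d) * ?S =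
      (\<integral>\<^sup>+ \<mu>. ennreal ((1 + (1 - 1 / r\<^sup>2) / (2 * \<sigma>\<^sup>2) * (norm (\<mu> - x))\<^sup>2) *
          mvn_density \<sigma> x \<mu> / r ^ d) * f \<mu> \<partial>lborel)"
    proof -
      have "ennreal (1 / r ^ d) * (ennreal (mvn_density \<sigma> x \<mu>) * f \<mu>) +
          ennreal ((1 - 1 / r\<^sup>2) / (2 * \<sigma>\<^sup>2) / r ^ d) *
          (ennreal ((norm (\<mu> - x))\<^sup>2 * mvn_density \<sigma> x \<mu>) * f \<mu>) =
        ennreal ((1 + (1 - 1 / r\<^sup>2) / (2 * \<sigma>\<^sup>2) * (norm (\<mu> - x))\<^sup>2) *
          mvn_density \<sigma> x \<mu> / r ^ d) * f \<mu>" for \<mu>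
      proof -
        have e: "(1 + (1 - 1 / r\<^sup>2) / (2 * \<sigma>\<^sup>2) * (norm (\<mu> - x))\<^sup>2) * mvn_density \<sigma> x \<mu> / r ^ d =
          1 / r ^ d * mvn_density \<sigma> x \<mu> +
          (1 - 1 / r\<^sup>2) / (2 * \<sigma>\<^sup>2) / r ^ d * ((norm (\<mu> - x))\<^sup>2 * mvn_density \<sigma> x \<mu>)"
          by (simp add: distrib_right add_divide_distrib)
        show ?thesis
          unfolding e using r k
          by (simp only: ennreal_plus ennreal_mult mult.assoc distrib_right
              divide_nonneg_nonneg mult_nonneg_nonneg mvn_density_nonneg zero_le_power2
              zero_le_one zero_le_power zero_le_numeral order_less_imp_le[OF r] order_trans[OF zero_le_one])
      qed
      then show ?thesis
        by (simp add: nn_integral_add[symmetric] nn_integral_cmult[symmetric])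
    qed
    also have "\<dots> \<le> (\<integral>\<^sup>+ \<mu>. ennreal (mvn_density (r * \<sigma>) x \<mu>) * f \<mu> \<partial>lborel)"
      using mvn_density_scale_ge[OF assms(2) r, where 'a = 'a]
      by (intro nn_integral_mono mult_right_mono ennreal_leI) (auto simp: d_def)
    also have "\<dots> \<le> ?M"
      using assms r by (intro superharmonic_mvn_density_antimono) auto
    finally show ?thesis .
  qed
  \<comment> \<open>Any fixed \<open>r > 1\<close> would do, since \<open>?M\<close> is finite and
    the coefficient of \<open>?S\<close> is positive; 2 is taken.\<close>
  have "?S \<noteq> \<infinity>"
  proof
    assume "?S = \<infinity>"
    moreover have "ennreal ((1 - 1 / 2\<^sup>2) / (2 * \<sigma>\<^sup>2) / 2 ^ d) \<noteq> 0"
      using assms(2) by (simp add: ennreal_eq_0_iff not_le)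
    ultimately have "ennreal ((1 - 1 / 2\<^sup>2) / (2 * \<sigma>\<^sup>2) / 2 ^ d) * ?S = \<infinity>"
      by (simp add: ennreal_mult_top)
    with ineq[of 2] False show False
      by (simp add: top_unique)
  qed
  then obtain s where s: "?S = ennreal s" "s \<ge> 0"
    by (cases ?S) auto
  \<comment> \<open>Both \<open>r^2 - 1\<close> and \<open>r^d - 1\<close> contain the factor
    \<open>r - 1\<close>. Once it is cancelled, \<open>r\<close> can tend to 1, where the geometric
    sum becomes \<open>d\<close>: this is the origin of the dimension in the bound.\<close>
  have "s * (r + 1) \<le> 2 * \<sigma>\<^sup>2 * r\<^sup>2 * (\<Sum>i<d. r ^ i) * m" if r: "r > 1" for r
  proof -
    have k: "0 \<le> (1 - 1 / r\<^sup>2) / (2 * \<sigma>\<^sup>2) / r ^ d" using r by simp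
    have "ennreal (1 / r ^ d * m + (1 - 1 / r\<^sup>2) / (2 * \<sigma>\<^sup>2) / r ^ d * s) \<le> ennreal m"
    proof -
      have "ennreal (1 / r ^ d * m + (1 - 1 / r\<^sup>2) / (2 * \<sigma>\<^sup>2) / r ^ d * s) =
          ennreal (1 / r ^ d) * ?M + ennreal ((1 - 1 / r\<^sup>2) / (2 * \<sigma>\<^sup>2) / r ^ d) * ?S"
        unfolding m s using m(2) s(2) k r
        by (subst ennreal_plus) (simp_all only: ennreal_mult mult_nonneg_nonneg zero_le_divide_1_iff
            zero_le_power order_less_imp_le[OF r] order_trans[OF zero_le_one])
      then show ?thesis
        using ineq[OF r] unfolding m(1) by simp
    qed
    then have "1 / r ^ d * m + (1 - 1 / r\<^sup>2) / (2 * \<sigma>\<^sup>2) / r ^ d * s \<le> m"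
      using m(2) by (simp add: ennreal_le_iff)
    then have "(1 / r ^ d * m + (1 - 1 / r\<^sup>2) / (2 * \<sigma>\<^sup>2) / r ^ d * s) * (r ^ d * (2 * \<sigma>\<^sup>2 * r\<^sup>2)) \<le>
        m * (r ^ d * (2 * \<sigma>\<^sup>2 * r\<^sup>2))"
      using r assms(2) by (intro mult_right_mono) auto
    moreover have "(1 / r ^ d * m + (1 - 1 / r\<^sup>2) / (2 * \<sigma>\<^sup>2) / r ^ d * s) * (r ^ d * (2 * \<sigma>\<^sup>2 * r\<^sup>2)) =
        2 * \<sigma>\<^sup>2 * r\<^sup>2 * m + (r\<^sup>2 - 1) * s"
      using r assms(2) by (simp add: field_simps)
    ultimately have "(r\<^sup>2 - 1) * s \<le> 2 * \<sigma>\<^sup>2 * r\<^sup>2 * (r ^ d - 1) * m"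
      by (simp add: algebra_simps)
    also have "r ^ d - 1 = (r - 1) * (\<Sum>i<d. r ^ i)"
      by (rule power_diff_1_eq)
    also have "r\<^sup>2 - 1 = (r - 1) * (r + 1)"
      by (simp add: power2_eq_square algebra_simps)
    finally have "(r - 1) * (s * (r + 1)) \<le> (r - 1) * (2 * \<sigma>\<^sup>2 * r\<^sup>2 * (\<Sum>i<d. r ^ i) * m)"
      by (simp only: mult_ac)
    then show ?thesis
      using r by (simp only: mult_le_cancel_left_pos diff_gt_0_iff_gt)
  qed
  then have ev: "\<forall>\<^sub>F r in at_right 1. s * (r + 1) \<le> 2 * \<sigma>\<^sup>2 * r\<^sup>2 * (\<Sum>i<d. r ^ i) * m"
    by (auto simp: eventually_at_right_field intro: exI[of _ 2])
  have "s * (1 + 1) \<le> 2 * \<sigma>\<^sup>2 * 1\<^sup>2 * (\<Sum>i<d. 1 ^ i) * m"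
    by (rule tendsto_le[OF trivial_limit_at_right_real _ _ ev]) (intro tendsto_intros)+
  then have "s \<le> d * \<sigma>\<^sup>2 * m"
    by (simp add: mult_ac)
  then show ?thesis
    unfolding m s d_def using m(2) by (simp add: ennreal_mult[symmetric] ennreal_leI)
qed

section \<open>The posterior under a superharmonic prior\<close>

text \<open>The factor 1 and the explicit exponents give these bounds the shape
  \<open>A * (1 + norm \<mu>) ^ k\<close> demanded by the integrability lemmas, so that they can be
  plugged in by resolution.\<close>

lemma abs_inner_le_moment:
  fixes \<mu> b :: "'a::real_inner"
  assumes "norm b = 1"
  shows "\<bar>\<mu> \<bullet> b\<bar> \<le> 1 * (1 + norm \<mu>) ^ 1" "\<bar>(\<mu> \<bullet> b)\<^sup>2\<bar> \<le> 1 * (1 + norm \<mu>) ^ 2"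
proof -
  have *: "\<bar>\<mu> \<bullet> b\<bar> \<le> norm \<mu>"
    using Cauchy_Schwarz_ineq2[of \<mu> b] assms by simp
  then show "\<bar>\<mu> \<bullet> b\<bar> \<le> 1 * (1 + norm \<mu>) ^ 1" by simp
  from * have "\<bar>\<mu> \<bullet> b\<bar> ^ 2 \<le> (1 + norm \<mu>) ^ 2"
    by (intro power_mono) auto
  then show "\<bar>(\<mu> \<bullet> b)\<^sup>2\<bar> \<le> 1 * (1 + norm \<mu>) ^ 2" by simp
qed

locale superharmonic_model =
  fixes \<sigma> :: real and \<pi> :: "'a::euclidean_space \<Rightarrow> ennreal"
  assumes sigma_pos: "\<sigma> > 0" and prior: "superharmonic_prior \<pi>"
begin

lemma superharmonic_pi: "superharmonic \<pi>"
  using prior by (simp add: superharmonic_prior_def)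

lemma pi_measurable [measurable]: "\<pi> \<in> borel_measurable borel"
  by (rule superharmonic_measurable[OF superharmonic_pi])

lemma ex_pi_finite: "\<exists>z. \<pi> z < \<infinity>"
proof (rule ccontr)
  assume "\<not> ?thesis"
  then have "\<pi> = (\<lambda>_. \<infinity>)"
    by (auto simp: less_top[symmetric])
  with prior show False
    by (simp add: superharmonic_prior_def)
qed

lemma emeasure_pi_pos: "emeasure lborel {\<mu>. 0 < \<pi> \<mu>} > 0"
proof (rule emeasure_lborel_open_pos)
  show "open {\<mu>. 0 < \<pi> \<mu>}"
    using superharmonic_pi by (simp add: superharmonic_def)
  show "{\<mu>. 0 < \<pi> \<mu>} \<noteq> {}"
  proof
    assume "{\<mu>. 0 < \<pi> \<mu>} = {}"
    then have "\<pi> = (\<lambda>_. 0)"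
      by (auto simp: zero_less_iff_neq_zero)
    with prior show False
      by (simp add: superharmonic_prior_def)
  qed
qed

section \<open>The prior as a real function, and its integrability against Gaussians\<close>

definition prior_density :: "'a \<Rightarrow> real" where
  "prior_density \<mu> = enn2real (\<pi> \<mu>)"

lemma prior_density_measurable [measurable]: "prior_density \<in> borel_measurable borel"
  unfolding prior_density_def by measurable

lemma prior_density_nonneg [simp]: "0 \<le> prior_density \<mu>"
  by (simp add: prior_density_def)

text \<open>At a point \<open>z\<close> with \<open>\<pi> z\<close> finite the Gaussian average is
  finite, and the Gaussian vanishes nowhere, so \<pi> is finite almost everywhere.\<close>

lemma AE_prior_density: "AE \<mu> in lborel. ennreal (prior_density \<mu>) = \<pi> \<mu>"
proof -
  obtain z where z: "\<pi> z < \<infinity>"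
    using ex_pi_finite by blast
  have "(\<integral>\<^sup>+ \<mu>. ennreal (mvn_density \<sigma> z \<mu>) * \<pi> \<mu> \<partial>lborel) \<noteq> \<infinity>"
    using superharmonic_mvn_density[OF superharmonic_pi sigma_pos, of z] z by auto
  then have "AE \<mu> in lborel. ennreal (mvn_density \<sigma> z \<mu>) * \<pi> \<mu> \<noteq> \<infinity>"
    by (intro nn_integral_PInf_AE) auto
  then show ?thesis
  proof eventually_elim
    case (elim \<mu>)
    then have "\<pi> \<mu> \<noteq> \<infinity>"
      using mvn_density_pos[OF sigma_pos, of z \<mu>] by (auto simp: ennreal_mult_top)
    then show ?case
      by (simp add: prior_density_def less_top)
  qed
qed

text \<open>The unnormalised posterior density of \<mu> given \<open>x\<close>; the symmetry of the
  Gaussian allows it to be centred at \<open>x\<close>, the variable in which it will be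
  differentiated.\<close>

definition weight :: "'a \<Rightarrow> 'a \<Rightarrow> real" where
  "weight x \<mu> = mvn_density \<sigma> x \<mu> * prior_density \<mu>"

lemma weight_measurable [measurable (raw)]:
  assumes [measurable]: "f \<in> borel_measurable M" "g \<in> borel_measurable M"
  shows "(\<lambda>x. weight (f x) (g x)) \<in> borel_measurable M"
  unfolding weight_def by measurable

lemma weight_nonneg [simp]: "0 \<le> weight x \<mu>"
  by (simp add: weight_def)

lemma nn_integral_weight:
  assumes [measurable]: "f \<in> borel_measurable borel"
  shows "(\<integral>\<^sup>+ \<mu>. f \<mu> * (ennreal (mvn_density \<sigma> \<mu> x) * \<pi> \<mu>) \<partial>lborel) =
    (\<integral>\<^sup>+ \<mu>. f \<mu> * ennreal (weight x \<mu>) \<partial>lborel)"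
proof (rule nn_integral_cong_AE)
  show "AE \<mu> in lborel. f \<mu> * (ennreal (mvn_density \<sigma> \<mu> x) * \<pi> \<mu>) = f \<mu> * ennreal (weight x \<mu>)"
    using AE_prior_density
    by eventually_elim (simp add: weight_def ennreal_mult mvn_density_commute[of \<sigma> _ x])
qed

text \<open>The dominating Gaussian is centred at a point \<open>z\<close> with
  \<open>\<pi> z\<close> finite, where its average of \<pi> is at most \<open>\<pi> z\<close>. This
  replaces any growth condition on the prior.\<close>

lemma weight_dominated:
  obtains G where "integrable lborel G"
    "\<And>y \<mu>. norm (y - x) \<le> 1 \<Longrightarrow> (1 + norm \<mu>) ^ k * weight y \<mu> \<le> G \<mu>"
proof -
  obtain z where z: "\<pi> z < \<infinity>"
    using ex_pi_finite by blast
  obtain K where K: "K \<ge> 0" "\<And>y \<mu>. norm (y - x) \<le> 1 \<Longrightarrow>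
    (1 + norm \<mu>) ^ k * mvn_density \<sigma> y \<mu> \<le> K * mvn_density (2 * \<sigma>) z \<mu>"
    using mvn_density_dominated[OF sigma_pos, of x k z] by blast
  have "(\<integral>\<^sup>+ \<mu>. ennreal (mvn_density (2 * \<sigma>) z \<mu> * prior_density \<mu>) \<partial>lborel) =
      (\<integral>\<^sup>+ \<mu>. ennreal (mvn_density (2 * \<sigma>) z \<mu>) * \<pi> \<mu> \<partial>lborel)"
    using AE_prior_density by (intro nn_integral_cong_AE) (auto simp: ennreal_mult)
  also have "\<dots> \<le> \<pi> z"
    using sigma_pos by (intro superharmonic_mvn_density superharmonic_pi) simp
  also have "\<dots> < \<infinity>" by (rule z)
  finally have "integrable lborel (\<lambda>\<mu>. mvn_density (2 * \<sigma>) z \<mu> * prior_density \<mu>)"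
    by (intro integrableI_nonneg) auto
  then have "integrable lborel (\<lambda>\<mu>. K * (mvn_density (2 * \<sigma>) z \<mu> * prior_density \<mu>))"
    by simp
  moreover have "(1 + norm \<mu>) ^ k * weight y \<mu> \<le> K * (mvn_density (2 * \<sigma>) z \<mu> * prior_density \<mu>)"
    if "norm (y - x) \<le> 1" for y \<mu>
    using mult_right_mono[OF K(2)[OF that, of \<mu>], of "prior_density \<mu>"]
    by (simp add: weight_def mult.assoc)
  ultimately show thesis by (rule that)
qed

lemma integrable_weight_moment:
  assumes [measurable]: "g \<in> borel_measurable borel"
    and g: "\<And>\<mu>. \<bar>g \<mu>\<bar> \<le> A * (1 + norm \<mu>) ^ k"
  shows "integrable lborel (\<lambda>\<mu>. g \<mu> * weight x \<mu>)"
proof -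
  obtain G where G: "integrable lborel G"
    "\<And>y \<mu>. norm (y - x) \<le> 1 \<Longrightarrow> (1 + norm \<mu>) ^ k * weight y \<mu> \<le> G \<mu>"
    using weight_dominated by blast
  have A: "A \<ge> 0" using g[of 0] by simp
  show ?thesis
  proof (rule Bochner_Integration.integrable_bound)
    show "integrable lborel (\<lambda>\<mu>. A * G \<mu>)"
      using G(1) by simp
    show "AE \<mu> in lborel. norm (g \<mu> * weight x \<mu>) \<le> norm (A * G \<mu>)"
    proof (rule AE_I2)
      fix \<mu>
      have "norm (g \<mu> * weight x \<mu>) \<le> A * (1 + norm \<mu>) ^ k * weight x \<mu>"
        using g[of \<mu>] by (simp add: abs_mult mult_right_mono)
      also have "\<dots> \<le> A * G \<mu>"
        unfolding mult.assoc using A G(2)[of x \<mu>] by (intro mult_left_mono) auto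
      finally show "norm (g \<mu> * weight x \<mu>) \<le> norm (A * G \<mu>)"
        by simp
    qed
  qed measurable
qed

lemma integrable_weight [simp]: "integrable lborel (weight x)"
  using integrable_weight_moment[of "\<lambda>_. 1" 1 0] by simp

lemma integrable_weight_inner: "norm b = 1 \<Longrightarrow> integrable lborel (\<lambda>\<mu>. (\<mu> \<bullet> b) * weight x \<mu>)"
  by (rule integrable_weight_moment[OF _ abs_inner_le_moment(1)]) auto

lemma integrable_weight_inner_sq: "norm b = 1 \<Longrightarrow> integrable lborel (\<lambda>\<mu>. (\<mu> \<bullet> b)\<^sup>2 * weight x \<mu>)"
  by (rule integrable_weight_moment[OF _ abs_inner_le_moment(2)]) auto

lemma integrable_weight_norm_sq: "integrable lborel (\<lambda>\<mu>. (norm (\<mu> - c))\<^sup>2 * weight x \<mu>)"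
  using norm_diff_sq_le_moment[of _ c]
  by (intro integrable_weight_moment[of _ "(1 + norm c)\<^sup>2" 2]) auto

lemma integrable_weight_id: "integrable lborel (\<lambda>\<mu>. weight x \<mu> *\<^sub>R \<mu>)"
proof (rule Bochner_Integration.integrable_bound[of _ "\<lambda>\<mu>. (1 + norm \<mu>) * weight x \<mu>"])
  show "integrable lborel (\<lambda>\<mu>. (1 + norm \<mu>) * weight x \<mu>)"
    by (rule integrable_weight_moment[of _ 1 1]) auto
  show "AE \<mu> in lborel. norm (weight x \<mu> *\<^sub>R \<mu>) \<le> norm ((1 + norm \<mu>) * weight x \<mu>)"
    by (rule AE_I2) (simp add: mult.commute mult_right_mono)
qed measurable

section \<open>The marginal density, the posterior mean and the posterior variances\<close>

definition marginal :: "'a \<Rightarrow> real" where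
  "marginal x = (\<integral>\<mu>. weight x \<mu> \<partial>lborel)"

lemma marginal_measurable [measurable]: "marginal \<in> borel_measurable borel"
  unfolding marginal_def by measurable

text \<open>Lower semicontinuity makes the positivity set of \<pi> open, hence of positive measure,
  and the kernel is positive everywhere. The divisions by the marginal rest on this.\<close>

lemma marginal_pos: "marginal x > 0"
proof -
  have "\<not> (AE \<mu> in lborel. weight x \<mu> = 0)"
  proof
    assume "AE \<mu> in lborel. weight x \<mu> = 0"
    then have "AE \<mu> in lborel. \<not> 0 < \<pi> \<mu>"
      using AE_prior_density
    proof eventually_elim
      case (elim \<mu>)
      then have "prior_density \<mu> = 0"
        using mvn_density_pos[OF sigma_pos, of x \<mu>] by (simp add: weight_def)
      with elim show ?case by simp
    qed
    moreover have "(AE \<mu> in lborel. \<not> 0 < \<pi> \<mu>) \<longleftrightarrow> emeasure lborel {\<mu>. 0 < \<pi> \<mu>} = 0"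
      by (rule AE_iff_measurable) (auto simp: zero_less_iff_neq_zero)
    ultimately have "emeasure lborel {\<mu>. 0 < \<pi> \<mu>} = 0"
      by blast
    with emeasure_pi_pos show False by simp
  qed
  then have "marginal x \<noteq> 0"
    unfolding marginal_def by (subst integral_nonneg_eq_0_iff_AE) auto
  moreover have "marginal x \<ge> 0"
    unfolding marginal_def by simp
  ultimately show ?thesis by simp
qed

lemma posterior_normalizer:
  "(\<integral>\<^sup>+ \<mu>. ennreal (mvn_density \<sigma> \<mu> x) * \<pi> \<mu> \<partial>lborel) = ennreal (marginal x)"
proof -
  have "(\<integral>\<^sup>+ \<mu>. ennreal (mvn_density \<sigma> \<mu> x) * \<pi> \<mu> \<partial>lborel) = (\<integral>\<^sup>+ \<mu>. ennreal (weight x \<mu>) \<partial>lborel)"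
    using nn_integral_weight[of "\<lambda>_. 1" x] by simp
  then show ?thesis
    by (simp add: marginal_def nn_integral_eq_integral)
qed

definition post_mean :: "'a \<Rightarrow> 'a" where
  "post_mean = posterior_mean \<sigma> \<pi>"

lemma post_mean_eq: "post_mean x = (\<integral>\<mu>. weight x \<mu> *\<^sub>R \<mu> \<partial>lborel) /\<^sub>R marginal x"
  by (simp add: post_mean_def posterior_mean_def marginal_def weight_def prior_density_def
      mvn_density_commute[of \<sigma> _ x])

lemma post_mean_measurable [measurable]: "post_mean \<in> borel_measurable borel"
  unfolding post_mean_eq by measurable

lemma integral_weight_inner: "(\<integral>\<mu>. (\<mu> \<bullet> b) * weight x \<mu> \<partial>lborel) = (post_mean x \<bullet> b) * marginal x"
proof -
  have "(\<integral>\<mu>. weight x \<mu> *\<^sub>R \<mu> \<partial>lborel) \<bullet> b = (\<integral>\<mu>. weight x \<mu> *\<^sub>R \<mu> \<bullet> b \<partial>lborel)"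
    using integral_inner_left[of b, OF integrable_weight_id] by simp
  then show ?thesis
    using marginal_pos[of x] by (simp add: post_mean_eq mult.commute)
qed

text \<open>The posterior variance of \<open>\<mu> . b\<close>. Over \<open>Basis\<close> these sum
  to the trace of the posterior covariance, the only feature of the covariance that the risk
  sees.\<close>

definition post_var :: "'a \<Rightarrow> 'a \<Rightarrow> real" where
  "post_var b x = (\<integral>\<mu>. (\<mu> \<bullet> b - post_mean x \<bullet> b)\<^sup>2 * weight x \<mu> \<partial>lborel) / marginal x"

lemma post_var_measurable [measurable]: "post_var b \<in> borel_measurable borel"
  unfolding post_var_def by measurable

lemma post_var_nonneg: "0 \<le> post_var b x"
  using marginal_pos[of x] by (simp add: post_var_def)

lemma integral_weight_inner_sq:
  assumes "norm b = 1"
  shows "(\<integral>\<mu>. (\<mu> \<bullet> b - c)\<^sup>2 * weight x \<mu> \<partial>lborel) =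
    (post_var b x + (post_mean x \<bullet> b - c)\<^sup>2) * marginal x"
proof -
  \<comment> \<open>Stated for every \<open>c\<close> because it is applied twice: at the given
    point and at the posterior mean, where the left side is the variance.\<close>
  have *: "(\<integral>\<mu>. (\<mu> \<bullet> b - c)\<^sup>2 * weight x \<mu> \<partial>lborel) =
      (\<integral>\<mu>. (\<mu> \<bullet> b)\<^sup>2 * weight x \<mu> \<partial>lborel) - 2 * c * ((post_mean x \<bullet> b) * marginal x) + c\<^sup>2 * marginal x"
    for c
  proof -
    have "(\<integral>\<mu>. (\<mu> \<bullet> b - c)\<^sup>2 * weight x \<mu> \<partial>lborel) =
        (\<integral>\<mu>. (\<mu> \<bullet> b)\<^sup>2 * weight x \<mu> - 2 * c * ((\<mu> \<bullet> b) * weight x \<mu>) + c\<^sup>2 * weight x \<mu> \<partial>lborel)"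
      by (intro Bochner_Integration.integral_cong) (auto simp: power2_eq_square algebra_simps)
    also have "\<dots> = (\<integral>\<mu>. (\<mu> \<bullet> b)\<^sup>2 * weight x \<mu> \<partial>lborel) -
        2 * c * (\<integral>\<mu>. (\<mu> \<bullet> b) * weight x \<mu> \<partial>lborel) + c\<^sup>2 * (\<integral>\<mu>. weight x \<mu> \<partial>lborel)"
      using integrable_weight_inner[OF assms, of x] integrable_weight_inner_sq[OF assms, of x]
      by simp
    finally show ?thesis
      by (simp add: integral_weight_inner marginal_def)
  qed
  have "post_var b x * marginal x = (\<integral>\<mu>. (\<mu> \<bullet> b - post_mean x \<bullet> b)\<^sup>2 * weight x \<mu> \<partial>lborel)"
    using marginal_pos[of x] by (simp add: post_var_def)
  then show ?thesis
    unfolding * by (simp add: power2_eq_square algebra_simps)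
qed

text \<open>The bias-variance split about an arbitrary point: \<open>c = x\<close> serves Stein's
  argument, and \<open>c\<close> the mean of a competing density serves the posterior loss.\<close>

lemma integral_weight_norm_sq:
  "(\<integral>\<mu>. (norm (\<mu> - c))\<^sup>2 * weight x \<mu> \<partial>lborel) =
    ((\<Sum>b\<in>Basis. post_var b x) + (norm (post_mean x - c))\<^sup>2) * marginal x"
proof -
  have n: "(norm (y - c))\<^sup>2 = (\<Sum>b\<in>Basis. (y \<bullet> b - c \<bullet> b)\<^sup>2)" for y
    unfolding power2_norm_eq_inner
    by (subst euclidean_inner) (simp add: inner_diff_left power2_eq_square)
  have "integrable lborel (\<lambda>\<mu>. (\<mu> \<bullet> b - c \<bullet> b)\<^sup>2 * weight x \<mu>)" if "b \<in> Basis" for b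
  proof (rule integrable_weight_moment[of _ "(1 + norm c)\<^sup>2" 2])
    fix \<mu>
    show "\<bar>(\<mu> \<bullet> b - c \<bullet> b)\<^sup>2\<bar> \<le> (1 + norm c)\<^sup>2 * (1 + norm \<mu>)\<^sup>2"
      using power_mono[OF Basis_le_norm[OF that, of "\<mu> - c"] abs_ge_zero, of 2]
        norm_diff_sq_le_moment[of \<mu> c] by (simp add: inner_diff_left)
  qed measurable
  then have "(\<integral>\<mu>. (norm (\<mu> - c))\<^sup>2 * weight x \<mu> \<partial>lborel) =
      (\<Sum>b\<in>Basis. \<integral>\<mu>. (\<mu> \<bullet> b - c \<bullet> b)\<^sup>2 * weight x \<mu> \<partial>lborel)"
    unfolding n sum_distrib_right by (rule Bochner_Integration.integral_sum)
  also have "\<dots> = (\<Sum>b\<in>Basis. (post_var b x + (post_mean x \<bullet> b - c \<bullet> b)\<^sup>2) * marginal x)"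
    by (intro sum.cong refl integral_weight_inner_sq) simp
  finally show ?thesis
    unfolding n by (simp add: sum.distrib distrib_right sum_distrib_right)
qed

text \<open>The second-moment inequality for Gaussian averages, divided by the marginal and split
  about \<open>x\<close>. Both summands are nonnegative, so each inherits the bound.\<close>

lemma post_second_moment_le:
  "(\<Sum>b\<in>Basis. post_var b x) + (norm (post_mean x - x))\<^sup>2 \<le> DIM('a) * \<sigma>\<^sup>2"
proof -
  have "ennreal (\<integral>\<mu>. (norm (\<mu> - x))\<^sup>2 * weight x \<mu> \<partial>lborel) =
      (\<integral>\<^sup>+ \<mu>. ennreal ((norm (\<mu> - x))\<^sup>2 * weight x \<mu>) \<partial>lborel)"
    by (intro nn_integral_eq_integral[symmetric] integrable_weight_norm_sq) simp
  also have "\<dots> = (\<integral>\<^sup>+ \<mu>. ennreal ((norm (\<mu> - x))\<^sup>2 * mvn_density \<sigma> x \<mu>) * \<pi> \<mu> \<partial>lborel)"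
    using nn_integral_weight[of "\<lambda>\<mu>. ennreal ((norm (\<mu> - x))\<^sup>2)" x]
    by (simp add: mvn_density_commute[of \<sigma> _ x] ennreal_mult mult.assoc)
  also have "\<dots> \<le> ennreal (DIM('a) * \<sigma>\<^sup>2) * (\<integral>\<^sup>+ \<mu>. ennreal (mvn_density \<sigma> x \<mu>) * \<pi> \<mu> \<partial>lborel)"
    by (rule superharmonic_second_moment[OF superharmonic_pi sigma_pos])
  also have "\<dots> = ennreal (DIM('a) * \<sigma>\<^sup>2 * marginal x)"
    using marginal_pos[of x] posterior_normalizer[of x]
    by (simp add: ennreal_mult mvn_density_commute[of \<sigma> _ x])
  finally have "((\<Sum>b\<in>Basis. post_var b x) + (norm (post_mean x - x))\<^sup>2) * marginal x \<le>
      DIM('a) * \<sigma>\<^sup>2 * marginal x"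
    using marginal_pos[of x] by (simp add: integral_weight_norm_sq ennreal_le_iff)
  then show ?thesis
    using marginal_pos[of x] by simp
qed

lemma post_var_le:
  assumes "b \<in> Basis"
  shows "post_var b x \<le> DIM('a) * \<sigma>\<^sup>2"
  using post_second_moment_le[of x] member_le_sum[of b Basis "\<lambda>b. post_var b x"] assms
    post_var_nonneg[of _ x] by (smt (verit) finite_Basis zero_le_power2)

text \<open>Moving \<open>x\<close> along \<open>b\<close> multiplies the weight by
  \<open>(\<mu> - x) . b / \<sigma>^2\<close>. The quotient rule therefore produces the posterior
  covariance of \<open>\<mu> . b\<close> with this factor, which is the variance divided by
  \<open>\<sigma>^2\<close>.\<close>

lemma post_mean_has_derivative:
  assumes b: "norm b = 1"
  shows "((\<lambda>t. post_mean (x + t *\<^sub>R b) \<bullet> b) has_real_derivative post_var b x / \<sigma>\<^sup>2) (at 0)"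
proof -
  have bb: "b \<bullet> b = 1"
    using b by (simp add: norm_eq_1)
  let ?w = "\<lambda>t \<mu>. weight (x + t *\<^sub>R b) \<mu>"
  let ?l = "\<lambda>t \<mu>. ((\<mu> - (x + t *\<^sub>R b)) \<bullet> b) / \<sigma>\<^sup>2"
  have dw: "((\<lambda>t. ?w t \<mu>) has_real_derivative ?l t \<mu> * ?w t \<mu>) (at t)" for t \<mu>
    unfolding weight_def mult.assoc[symmetric]
    by (intro DERIV_cmult_right mvn_density_has_derivative sigma_pos b)
  \<comment> \<open>Two powers cover the numerator, where the integrand \<open>\<mu> . b\<close>
    meets the linear factor created by differentiation; the marginal needs only one.\<close>
  obtain G where G: "integrable lborel G"
    "\<And>y \<mu>. norm (y - x) \<le> 1 \<Longrightarrow> (1 + norm \<mu>) ^ 2 * weight y \<mu> \<le> G \<mu>"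
    using weight_dominated[of x 2] by blast
  define C where "C = (2 + norm x) / \<sigma>\<^sup>2"
  have C: "C \<ge> 0" by (simp add: C_def)
  have l: "\<bar>?l t \<mu>\<bar> \<le> C * (1 + norm \<mu>)" if "\<bar>t\<bar> < 1" for t \<mu>
  proof -
    have "\<bar>(\<mu> - (x + t *\<^sub>R b)) \<bullet> b\<bar> \<le> norm (\<mu> - (x + t *\<^sub>R b))"
      using Cauchy_Schwarz_ineq2[of "\<mu> - (x + t *\<^sub>R b)" b] b by simp
    also have "\<dots> \<le> norm \<mu> + (norm x + 1)"
      using that norm_triangle_ineq4[of \<mu> "x + t *\<^sub>R b"] norm_triangle_ineq[of x "t *\<^sub>R b"] b by simp
    also have "\<dots> \<le> (2 + norm x) * (1 + norm \<mu>)"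
      by (simp add: algebra_simps)
    finally have "\<bar>(\<mu> - (x + t *\<^sub>R b)) \<bullet> b\<bar> / \<sigma>\<^sup>2 \<le> (2 + norm x) * (1 + norm \<mu>) / \<sigma>\<^sup>2"
      by (rule divide_right_mono) simp
    then show ?thesis by (simp add: C_def)
  qed
  have bound: "\<bar>?l t \<mu> * ?w t \<mu>\<bar> \<le> C * G \<mu>" "\<bar>(\<mu> \<bullet> b) * (?l t \<mu> * ?w t \<mu>)\<bar> \<le> C * G \<mu>"
    if t: "\<bar>t - 0\<bar> < 1" for t \<mu>
  proof -
    have G': "(1 + norm \<mu>) ^ 2 * ?w t \<mu> \<le> G \<mu>"
      using t b by (intro G(2)) simp
    have "\<bar>?l t \<mu> * ?w t \<mu>\<bar> \<le> C * (1 + norm \<mu>) * ?w t \<mu>"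
      unfolding abs_mult using l[of t \<mu>] t C by (intro mult_mono) auto
    moreover have "C * (1 + norm \<mu>) * ?w t \<mu> \<le> (1 + norm \<mu>) * (C * (1 + norm \<mu>) * ?w t \<mu>)"
      using C by (simp add: algebra_simps)
    moreover have "(1 + norm \<mu>) * (C * (1 + norm \<mu>) * ?w t \<mu>) = C * ((1 + norm \<mu>) ^ 2 * ?w t \<mu>)"
      by (simp add: power2_eq_square)
    moreover have "C * ((1 + norm \<mu>) ^ 2 * ?w t \<mu>) \<le> C * G \<mu>"
      using G' C by (rule mult_left_mono)
    ultimately show "\<bar>?l t \<mu> * ?w t \<mu>\<bar> \<le> C * G \<mu>" by linarith
    have "\<bar>(\<mu> \<bullet> b) * (?l t \<mu> * ?w t \<mu>)\<bar> \<le> (1 + norm \<mu>) * (C * (1 + norm \<mu>) * ?w t \<mu>)"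
      unfolding abs_mult[of "\<mu> \<bullet> b"]
      using abs_inner_le_moment(1)[OF b, of \<mu>] \<open>\<bar>?l t \<mu> * ?w t \<mu>\<bar> \<le> C * (1 + norm \<mu>) * ?w t \<mu>\<close>
      by (intro mult_mono) auto
    also have "\<dots> \<le> C * G \<mu>"
      unfolding \<open>(1 + norm \<mu>) * (C * (1 + norm \<mu>) * ?w t \<mu>) = C * ((1 + norm \<mu>) ^ 2 * ?w t \<mu>)\<close>
      by fact
    finally show "\<bar>(\<mu> \<bullet> b) * (?l t \<mu> * ?w t \<mu>)\<bar> \<le> C * G \<mu>" .
  qed
  have CG: "integrable lborel (\<lambda>\<mu>. C * G \<mu>)"
    using G(1) by simp
  have D: "((\<lambda>t. marginal (x + t *\<^sub>R b)) has_real_derivative (\<integral>\<mu>. ?l 0 \<mu> * ?w 0 \<mu> \<partial>lborel)) (at 0)"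
    unfolding marginal_def
    by (rule has_real_derivative_integral[where e = 1 and g = "\<lambda>\<mu>. C * G \<mu>"
          and f' = "\<lambda>t \<mu>. ?l t \<mu> * ?w t \<mu>"]) (use dw bound CG in auto)
  have N: "((\<lambda>t. \<integral>\<mu>. (\<mu> \<bullet> b) * ?w t \<mu> \<partial>lborel) has_real_derivative
      (\<integral>\<mu>. (\<mu> \<bullet> b) * (?l 0 \<mu> * ?w 0 \<mu>) \<partial>lborel)) (at 0)"
  proof (rule has_real_derivative_integral[where e = 1 and g = "\<lambda>\<mu>. C * G \<mu>"
        and f' = "\<lambda>t \<mu>. (\<mu> \<bullet> b) * (?l t \<mu> * ?w t \<mu>)"])
    show "((\<lambda>t. (\<mu> \<bullet> b) * ?w t \<mu>) has_real_derivative (\<mu> \<bullet> b) * (?l t \<mu> * ?w t \<mu>)) (at t)" for t \<mu>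
      by (rule DERIV_cmult[OF dw])
    show "\<bar>(\<mu> \<bullet> b) * (?l t \<mu> * ?w t \<mu>)\<bar> \<le> C * G \<mu>" if "\<bar>t - 0\<bar> < 1" for t \<mu>
      by (rule bound(2)[OF that])
  qed (use CG integrable_weight_inner[OF b] in auto)
  define T where "T = post_mean x \<bullet> b"
  define m where "m = marginal x"
  have m: "m > 0" by (simp add: m_def marginal_pos)
  have second: "(\<integral>\<mu>. (\<mu> \<bullet> b)\<^sup>2 * weight x \<mu> \<partial>lborel) = (post_var b x + T\<^sup>2) * m"
    using integral_weight_inner_sq[OF b, of 0 x] by (simp add: T_def m_def)
  have first: "(\<integral>\<mu>. (\<mu> \<bullet> b) * weight x \<mu> \<partial>lborel) = T * m"
    by (simp add: integral_weight_inner T_def m_def)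
  have D0: "(\<integral>\<mu>. ?l 0 \<mu> * ?w 0 \<mu> \<partial>lborel) = (T - x \<bullet> b) * m / \<sigma>\<^sup>2"
  proof -
    have "(\<integral>\<mu>. ?l 0 \<mu> * ?w 0 \<mu> \<partial>lborel) =
        (\<integral>\<mu>. ((\<mu> \<bullet> b) * weight x \<mu> - (x \<bullet> b) * weight x \<mu>) / \<sigma>\<^sup>2 \<partial>lborel)"
      by (intro Bochner_Integration.integral_cong) (auto simp: inner_diff_left algebra_simps diff_divide_distrib)
    also have "\<dots> = (T * m - (x \<bullet> b) * m) / \<sigma>\<^sup>2"
      using integrable_weight_inner[OF b, of x] first by (simp add: m_def marginal_def)
    finally show ?thesis by (simp add: algebra_simps)
  qed
  have N0: "(\<integral>\<mu>. (\<mu> \<bullet> b) * (?l 0 \<mu> * ?w 0 \<mu>) \<partial>lborel) = (post_var b x + T\<^sup>2 - (x \<bullet> b) * T) * m / \<sigma>\<^sup>2"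
  proof -
    have "(\<integral>\<mu>. (\<mu> \<bullet> b) * (?l 0 \<mu> * ?w 0 \<mu>) \<partial>lborel) =
        (\<integral>\<mu>. ((\<mu> \<bullet> b)\<^sup>2 * weight x \<mu> - (x \<bullet> b) * ((\<mu> \<bullet> b) * weight x \<mu>)) / \<sigma>\<^sup>2 \<partial>lborel)"
      by (intro Bochner_Integration.integral_cong)
         (auto simp: inner_diff_left algebra_simps diff_divide_distrib power2_eq_square)
    also have "\<dots> = ((post_var b x + T\<^sup>2) * m - (x \<bullet> b) * (T * m)) / \<sigma>\<^sup>2"
      using integrable_weight_inner[OF b, of x] integrable_weight_inner_sq[OF b, of x] first second
      by simp
    finally show ?thesis by (simp add: algebra_simps)
  qed
  have eq: "post_mean y \<bullet> b = (\<integral>\<mu>. (\<mu> \<bullet> b) * weight y \<mu> \<partial>lborel) / marginal y" for y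
    using marginal_pos[of y] by (simp add: integral_weight_inner)
  have "((\<lambda>t. (\<integral>\<mu>. (\<mu> \<bullet> b) * ?w t \<mu> \<partial>lborel) / marginal (x + t *\<^sub>R b)) has_real_derivative
      ((post_var b x + T\<^sup>2 - (x \<bullet> b) * T) * m / \<sigma>\<^sup>2 * m - T * m * ((T - x \<bullet> b) * m / \<sigma>\<^sup>2)) / (m * m))
      (at 0)"
    using DERIV_divide[OF N D] m unfolding N0 D0 by (simp add: first m_def)
  moreover have "((post_var b x + T\<^sup>2 - (x \<bullet> b) * T) * m / \<sigma>\<^sup>2 * m - T * m * ((T - x \<bullet> b) * m / \<sigma>\<^sup>2)) / (m * m) =
      post_var b x / \<sigma>\<^sup>2"
    using m sigma_pos by (simp add: field_simps power2_eq_square)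
  ultimately show ?thesis
    unfolding eq by simp
qed

lemma norm_post_mean_diff_sq: "(norm (post_mean x - x))\<^sup>2 \<le> DIM('a) * \<sigma>\<^sup>2"
  using post_second_moment_le[of x] sum_nonneg[of Basis "\<lambda>b. post_var b x"] post_var_nonneg
  by (smt (verit))

lemma norm_post_mean_le: "norm (post_mean x) \<le> (1 + sqrt (DIM('a) * \<sigma>\<^sup>2)) * (1 + norm x)"
proof -
  have "norm (post_mean x - x) \<le> sqrt (DIM('a) * \<sigma>\<^sup>2)"
    using norm_post_mean_diff_sq[of x] by (intro real_le_rsqrt)
  then have "norm (post_mean x) \<le> norm x + sqrt (DIM('a) * \<sigma>\<^sup>2)"
    using norm_triangle_sub[of "post_mean x" x] by simp
  also have "\<dots> \<le> (1 + sqrt (DIM('a) * \<sigma>\<^sup>2)) * (1 + norm x)"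
    by (simp add: algebra_simps)
  finally show ?thesis .
qed

text \<open>The factor \<open>\<sigma>^2\<close> of Stein's identity cancels against the derivative
  of the posterior mean; the bounds on variance and displacement supply its growth
  hypotheses.\<close>

lemma stein_post_mean:
  assumes b: "b \<in> Basis"
  shows "(\<integral>x. ((x - \<theta>) \<bullet> b) * (post_mean x \<bullet> b) * mvn_density \<sigma> \<theta> x \<partial>lborel) =
    (\<integral>x. post_var b x * mvn_density \<sigma> \<theta> x \<partial>lborel)"
proof -
  have "(\<integral>x. ((x - \<theta>) \<bullet> b) * (post_mean x \<bullet> b) * mvn_density \<sigma> \<theta> x \<partial>lborel) =
    \<sigma>\<^sup>2 * (\<integral>x. post_var b x / \<sigma>\<^sup>2 * mvn_density \<sigma> \<theta> x \<partial>lborel)"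
  proof (rule stein_identity[OF sigma_pos, where C = "DIM('a)" and A = "1 + sqrt (DIM('a) * \<sigma>\<^sup>2)"])
    fix x
    show "((\<lambda>t. post_mean (x + t *\<^sub>R b) \<bullet> b) has_real_derivative post_var b x / \<sigma>\<^sup>2) (at 0)"
      using b by (intro post_mean_has_derivative) simp
    show "\<bar>post_var b x / \<sigma>\<^sup>2\<bar> \<le> DIM('a)"
      using post_var_le[OF b, of x] post_var_nonneg[of b x] sigma_pos by (simp add: field_simps)
    show "\<bar>post_mean x \<bullet> b\<bar> \<le> (1 + sqrt (DIM('a) * \<sigma>\<^sup>2)) * (1 + norm x)"
      using Basis_le_norm[OF b, of "post_mean x"] norm_post_mean_le[of x] by linarith
  qed (use b in auto)
  then show ?thesis
    using sigma_pos by simp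
qed

text \<open>With \<open>e = x - \<theta>\<close> we have \<open>\<bar>T - \<theta>\<bar>\<^sup>2 = \<bar>T - x\<bar>\<^sup>2 + 2 e \<bullet> T - 2 e \<bullet> x + \<bar>e\<bar>\<^sup>2\<close>;
  by Stein's identity \<open>e \<bullet> T\<close> has the same expectation as the trace \<open>v\<close> of the posterior
  covariance, so the risk is \<open>E (2 (v + \<bar>T - x\<bar>\<^sup>2) - \<bar>T - x\<bar>\<^sup>2) - d \<sigma>\<^sup>2\<close>, in which
  \<open>v + \<bar>T - x\<bar>\<^sup>2 \<le> d \<sigma>\<^sup>2\<close>.\<close>

lemma post_mean_risk:
  "(\<integral>\<^sup>+ x. ennreal ((norm (\<theta> - post_mean x))\<^sup>2) * ennreal (mvn_density \<sigma> \<theta> x) \<partial>lborel) \<le>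
    ennreal (DIM('a) * \<sigma>\<^sup>2)"
proof -
  define d\<sigma> where "d\<sigma> = DIM('a) * \<sigma>\<^sup>2"
  define A where "A = 1 + sqrt d\<sigma>"
  define v where "v x = (\<Sum>b\<in>Basis. post_var b x)" for x
  let ?p = "mvn_density \<sigma> \<theta>"
  have A: "A \<ge> 1" by (simp add: A_def d\<sigma>_def)
  have [measurable]: "v \<in> borel_measurable borel"
    unfolding v_def by measurable
  have T: "norm (post_mean x) \<le> A * (1 + norm x)" for x
    using norm_post_mean_le[of x] by (simp add: A_def d\<sigma>_def)
  have e: "norm (x - \<theta>) \<le> (1 + norm \<theta>) * (1 + norm x)" for x
  proof -
    have "norm (x - \<theta>) \<le> norm x + norm \<theta>" by (rule norm_triangle_ineq4)
    also have "\<dots> \<le> (1 + norm \<theta>) * (1 + norm x)" by (simp add: algebra_simps)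
    finally show ?thesis .
  qed
  have v: "v x + (norm (post_mean x - x))\<^sup>2 \<le> d\<sigma>" "0 \<le> v x" for x
    using post_second_moment_le[of x] by (auto simp: v_def d\<sigma>_def intro: sum_nonneg post_var_nonneg)
  \<comment> \<open>One quadratic majorant for inner products of vectors growing at most linearly in
    \<open>x\<close>; it serves several of the integrability claims below.\<close>
  have prod: "\<bar>y \<bullet> z\<bar> \<le> (B * C) * (1 + norm x) ^ 2"
    if "norm y \<le> B * (1 + norm x)" "norm z \<le> C * (1 + norm x)" "B \<ge> 0" for x y z :: 'a and B C
  proof -
    have "\<bar>y \<bullet> z\<bar> \<le> norm y * norm z" by (rule Cauchy_Schwarz_ineq2)
    also have "\<dots> \<le> (B * (1 + norm x)) * (C * (1 + norm x))"
      using that by (intro mult_mono) auto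
    finally show ?thesis by (simp add: power2_eq_square mult_ac)
  qed
  have i1: "integrable lborel (\<lambda>x. (norm (post_mean x - \<theta>))\<^sup>2 * ?p x)"
  proof (rule integrable_mvn_density_moment[OF sigma_pos, of _ "(A + norm \<theta>) * (A + norm \<theta>)" 2])
    fix x
    have "norm (post_mean x - \<theta>) \<le> A * (1 + norm x) + norm \<theta>"
      using norm_triangle_ineq4[of "post_mean x" \<theta>] T[of x] by simp
    also have "\<dots> \<le> (A + norm \<theta>) * (1 + norm x)"
      by (simp add: algebra_simps)
    finally have "\<bar>(post_mean x - \<theta>) \<bullet> (post_mean x - \<theta>)\<bar> \<le>
      ((A + norm \<theta>) * (A + norm \<theta>)) * (1 + norm x) ^ 2"
      using A by (intro prod) auto
    then show "\<bar>(norm (post_mean x - \<theta>))\<^sup>2\<bar> \<le> (A + norm \<theta>) * (A + norm \<theta>) * (1 + norm x) ^ 2"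
      by (simp add: power2_norm_eq_inner)
  qed measurable
  have i2: "integrable lborel (\<lambda>x. v x * ?p x)"
  proof (rule integrable_mvn_density_moment[OF sigma_pos, of _ d\<sigma> 0])
    show "\<bar>v x\<bar> \<le> d\<sigma> * (1 + norm x) ^ 0" for x
    proof -
      have "v x \<le> v x + (norm (post_mean x - x))\<^sup>2" by simp
      also note v(1)
      finally show ?thesis using v(2)[of x] by simp
    qed
  qed measurable
  have i3: "integrable lborel (\<lambda>x. (norm (post_mean x - x))\<^sup>2 * ?p x)"
    using norm_post_mean_diff_sq
    by (intro integrable_mvn_density_moment[OF sigma_pos, of _ d\<sigma> 0]) (auto simp: d\<sigma>_def)
  have i4: "integrable lborel (\<lambda>x. (x - \<theta>) \<bullet> post_mean x * ?p x)"
    using T e prod by (intro integrable_mvn_density_moment[OF sigma_pos, of _ "(1 + norm \<theta>) * A" 2]) auto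
  have i5: "integrable lborel (\<lambda>x. (x - \<theta>) \<bullet> \<theta> * ?p x)"
    using e prod[of "_ - \<theta>" "1 + norm \<theta>" _ \<theta> "norm \<theta>"]
    by (intro integrable_mvn_density_moment[OF sigma_pos, of _ "(1 + norm \<theta>) * norm \<theta>" 2])
       (auto simp: mult_left_le algebra_simps)
  have i6: "integrable lborel (\<lambda>x. (norm (x - \<theta>))\<^sup>2 * ?p x)"
    by (rule integrable_mvn_density_norm_sq[OF sigma_pos])
  have stein: "(\<integral>x. (x - \<theta>) \<bullet> post_mean x * ?p x \<partial>lborel) = (\<integral>x. v x * ?p x \<partial>lborel)"
  proof -
    have "integrable lborel (\<lambda>x. ((x - \<theta>) \<bullet> b) * (post_mean x \<bullet> b) * ?p x)" if b: "b \<in> Basis" for b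
    proof (rule integrable_mvn_density_moment[OF sigma_pos, of _ "(1 + norm \<theta>) * A" 2])
      fix x
      have "\<bar>(x - \<theta>) \<bullet> b\<bar> * \<bar>post_mean x \<bullet> b\<bar> \<le> ((1 + norm \<theta>) * (1 + norm x)) * (A * (1 + norm x))"
        using Basis_le_norm[OF b, of "x - \<theta>"] Basis_le_norm[OF b, of "post_mean x"] T[of x] e[of x]
        by (intro mult_mono) auto
      then show "\<bar>((x - \<theta>) \<bullet> b) * (post_mean x \<bullet> b)\<bar> \<le> (1 + norm \<theta>) * A * (1 + norm x) ^ 2"
        by (simp add: abs_mult power2_eq_square mult_ac)
    qed measurable
    then have "(\<integral>x. (x - \<theta>) \<bullet> post_mean x * ?p x \<partial>lborel) =
        (\<Sum>b\<in>Basis. \<integral>x. ((x - \<theta>) \<bullet> b) * (post_mean x \<bullet> b) * ?p x \<partial>lborel)"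
      unfolding euclidean_inner[of "_ - \<theta>" "post_mean _"] sum_distrib_right
      by (rule Bochner_Integration.integral_sum)
    also have "\<dots> = (\<Sum>b\<in>Basis. \<integral>x. post_var b x * ?p x \<partial>lborel)"
      by (intro sum.cong refl stein_post_mean)
    also have "\<dots> = (\<integral>x. v x * ?p x \<partial>lborel)"
      unfolding v_def sum_distrib_right
    proof (rule Bochner_Integration.integral_sum[symmetric])
      fix b :: 'a assume "b \<in> Basis"
      then show "integrable lborel (\<lambda>x. post_var b x * ?p x)"
        using post_var_le post_var_nonneg
        by (intro integrable_mvn_density_moment[OF sigma_pos, of _ d\<sigma> 0]) (auto simp: d\<sigma>_def)
    qed
    finally show ?thesis .
  qed
  \<comment> \<open>Writing \<open>x = \<theta> + e\<close> turns \<open>-2 e . x + |e|^2\<close>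
    into \<open>-2 e . \<theta> - |e|^2\<close>. The first term has mean zero and the second has
    mean \<open>-d \<sigma>^2\<close>, which explains the negative constant in the risk.\<close>
  have pointwise: "(norm (post_mean x - \<theta>))\<^sup>2 * ?p x =
      (norm (post_mean x - x))\<^sup>2 * ?p x + 2 * ((x - \<theta>) \<bullet> post_mean x * ?p x) -
      2 * ((x - \<theta>) \<bullet> \<theta> * ?p x) - (norm (x - \<theta>))\<^sup>2 * ?p x" for x
    unfolding power2_norm_eq_inner
    by (simp add: inner_diff_left inner_diff_right inner_commute algebra_simps)
  have "(\<integral>x. (norm (post_mean x - \<theta>))\<^sup>2 * ?p x \<partial>lborel) =
      (\<integral>x. (norm (post_mean x - x))\<^sup>2 * ?p x \<partial>lborel) + 2 * (\<integral>x. v x * ?p x \<partial>lborel) - d\<sigma>"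
    unfolding pointwise using i3 i4 i5 i6
    by (simp add: stein integral_mvn_density_inner[OF sigma_pos] integral_mvn_density_norm_sq[OF sigma_pos]
        d\<sigma>_def)
  also have "\<dots> = (\<integral>x. ((norm (post_mean x - x))\<^sup>2 + 2 * v x) * ?p x \<partial>lborel) - d\<sigma>"
    using i2 i3 by (simp add: distrib_right mult.assoc)
  also have "\<dots> \<le> (\<integral>x. 2 * d\<sigma> * ?p x \<partial>lborel) - d\<sigma>"
  proof -
    have "(\<integral>x. ((norm (post_mean x - x))\<^sup>2 + 2 * v x) * ?p x \<partial>lborel) \<le> (\<integral>x. 2 * d\<sigma> * ?p x \<partial>lborel)"
    proof (rule integral_mono)
      show "integrable lborel (\<lambda>x. ((norm (post_mean x - x))\<^sup>2 + 2 * v x) * ?p x)"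
        using i2 i3 by (simp add: distrib_right mult.assoc)
      show "integrable lborel (\<lambda>x. 2 * d\<sigma> * ?p x)"
        using sigma_pos by simp
      fix x
      have "(norm (post_mean x - x))\<^sup>2 + 2 * v x \<le> 2 * d\<sigma>"
        using v[of x] zero_le_power2[of "norm (post_mean x - x)"] by linarith
      then show "((norm (post_mean x - x))\<^sup>2 + 2 * v x) * ?p x \<le> 2 * d\<sigma> * ?p x"
        by (rule mult_right_mono) simp
    qed
    then show ?thesis by simp
  qed
  also have "\<dots> = d\<sigma>"
    using sigma_pos by simp
  finally have le: "(\<integral>x. (norm (post_mean x - \<theta>))\<^sup>2 * ?p x \<partial>lborel) \<le> d\<sigma>" .
  have "(\<integral>\<^sup>+ x. ennreal ((norm (\<theta> - post_mean x))\<^sup>2) * ennreal (?p x) \<partial>lborel) =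
      ennreal (\<integral>x. (norm (post_mean x - \<theta>))\<^sup>2 * ?p x \<partial>lborel)"
    using i1 by (simp add: nn_integral_eq_integral[symmetric] ennreal_mult norm_minus_commute[of \<theta>])
  with le show ?thesis
    by (simp add: d\<sigma>_def ennreal_leI)
qed

text \<open>If \<open>\<integral> \<pi>\<close> were finite, then \<open>\<pi>\<close> would agree almost everywhere with its Gaussian averages,
  whose supremum tends to \<open>0\<close> as the variance grows.\<close>

lemma nn_integral_pi: "(\<integral>\<^sup>+ \<mu>. \<pi> \<mu> \<partial>lborel) = \<infinity>"
proof (rule ccontr)
  assume fin: "(\<integral>\<^sup>+ \<mu>. \<pi> \<mu> \<partial>lborel) \<noteq> \<infinity>"
  then obtain i where i: "(\<integral>\<^sup>+ \<mu>. \<pi> \<mu> \<partial>lborel) = ennreal i" "i \<ge> 0"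
    by (cases "\<integral>\<^sup>+ \<mu>. \<pi> \<mu> \<partial>lborel") auto
  obtain y where "0 < \<pi> y"
    using emeasure_pi_pos by (metis (mono_tags, lifting) Collect_empty_eq emeasure_empty less_irrefl)
  then obtain a' where a': "0 < a'" "a' < \<pi> y"
    using dense by blast
  then obtain a where a: "a' = ennreal a" "a > 0"
    by (cases a') (auto simp: less_top[symmetric])
  \<comment> \<open>The average of \<pi> is at most the Gaussian peak times the total mass
    \<open>i\<close>. With \<open>\<tau> \<ge> 1\<close> the peak is at most
    \<open>1 / \<tau>\<close> in every dimension, and this \<tau> makes \<open>i / \<tau>\<close>
    smaller than the level \<open>a\<close>.\<close>
  define \<tau> where "\<tau> = 1 + i / a"
  have \<tau>: "\<tau> \<ge> 1" "i / \<tau> < a"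
    using a i(2) by (simp_all add: \<tau>_def field_simps)
  let ?u = "\<lambda>x. \<integral>\<^sup>+ \<mu>. ennreal (mvn_density \<tau> x \<mu>) * \<pi> \<mu> \<partial>lborel"
  have u_le: "?u x \<le> \<pi> x" for x
    using \<tau> by (intro superharmonic_mvn_density superharmonic_pi) simp
  have "(\<integral>\<^sup>+ x. ?u x \<partial>lborel) = (\<integral>\<^sup>+ \<mu>. (\<integral>\<^sup>+ x. ennreal (mvn_density \<tau> x \<mu>) * \<pi> \<mu> \<partial>lborel) \<partial>lborel)"
    by (rule lborel_pair.Fubini') measurable
  also have "\<dots> = (\<integral>\<^sup>+ \<mu>. \<pi> \<mu> \<partial>lborel)"
    using \<tau> by (simp add: nn_integral_multc mvn_density_commute[of \<tau> _ "_::'a"] nn_integral_mvn_density)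
  finally have int_u: "(\<integral>\<^sup>+ x. ?u x \<partial>lborel) = (\<integral>\<^sup>+ \<mu>. \<pi> \<mu> \<partial>lborel)" .
  have "(\<integral>\<^sup>+ x. \<pi> x - ?u x \<partial>lborel) = 0"
    using fin u_le by (subst nn_integral_diff) (auto simp: int_u)
  then have "AE x in lborel. \<pi> x - ?u x = 0"
    by (subst (asm) nn_integral_0_iff_AE) auto
  then have "AE x in lborel. \<not> a' < \<pi> x"
  proof eventually_elim
    case (elim x)
    have "sqrt (2 * pi * \<tau>\<^sup>2) \<ge> \<tau>"
    proof (rule real_le_rsqrt)
      have "1 * \<tau>\<^sup>2 \<le> (2 * pi) * \<tau>\<^sup>2"
        using pi_gt3 by (intro mult_right_mono) auto
      then show "\<tau>\<^sup>2 \<le> 2 * pi * \<tau>\<^sup>2" by simp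
    qed
    moreover from this have "sqrt (2 * pi * \<tau>\<^sup>2) ^ DIM('a) \<ge> sqrt (2 * pi * \<tau>\<^sup>2) ^ 1"
      by (intro power_increasing order_trans[OF \<tau>(1)]) auto
    ultimately have "mvn_density \<tau> x \<mu> \<le> 1 / \<tau>" for \<mu>
      unfolding mvn_density_def using \<tau> by (intro frac_le) auto
    then have "?u x \<le> (\<integral>\<^sup>+ \<mu>. ennreal (1 / \<tau>) * \<pi> \<mu> \<partial>lborel)"
      by (intro nn_integral_mono mult_right_mono ennreal_leI) auto
    also have "\<dots> = ennreal (i / \<tau>)"
      using \<tau> i by (simp add: nn_integral_cmult ennreal_mult[symmetric])
    also have "\<dots> < a'"
      using \<tau> i a by (simp add: ennreal_less_iff)
    finally have "?u x < a'" .
    moreover have "\<pi> x \<le> ?u x"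
      using elim u_le[of x] by (simp add: diff_eq_0_iff_ennreal)
    ultimately show ?case by simp
  qed
  moreover have "(AE x in lborel. \<not> a' < \<pi> x) \<longleftrightarrow> emeasure lborel {x. a' < \<pi> x} = 0"
    by (rule AE_iff_measurable) auto
  moreover have "emeasure lborel {x. a' < \<pi> x} > 0"
    using superharmonic_pi a'(2) by (intro emeasure_lborel_open_pos) (auto simp: superharmonic_def)
  ultimately show False by simp
qed

end

section \<open>The Wasserstein loss\<close>

lemma ennreal_sqrt_power2 [simp]: "(ennreal_sqrt t)\<^sup>2 = t"
  by (cases t) (auto simp: ennreal_sqrt_def ennreal_power power2_eq_square ennreal_mult[symmetric])

lemma ennreal_sqrt_mono: "s \<le> t \<Longrightarrow> ennreal_sqrt s \<le> ennreal_sqrt t"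
  by (cases s; cases t) (auto simp: ennreal_sqrt_def ennreal_le_iff top_unique intro!: ennreal_leI)

definition coupling_cost :: "('a::euclidean_space \<times> 'a) measure \<Rightarrow> ennreal" where
  "coupling_cost \<gamma> = (\<integral>\<^sup>+ z. ennreal ((norm (fst z - snd z))\<^sup>2) \<partial>\<gamma>)"

text \<open>Squaring and \<open>ennreal_sqrt\<close> are monotone, and squaring undoes the root, so
  the square passes through the infimum and the root disappears from all later arguments.\<close>

lemma wasserstein2_power2: "(wasserstein2 M N)\<^sup>2 = (INF \<gamma>\<in>couplings M N. coupling_cost \<gamma>)"
proof (rule antisym)
  show "(wasserstein2 M N)\<^sup>2 \<le> (INF \<gamma>\<in>couplings M N. coupling_cost \<gamma>)"
  proof (rule INF_greatest)
    fix \<gamma> assume "\<gamma> \<in> couplings M N"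
    then have "wasserstein2 M N \<le> ennreal_sqrt (coupling_cost \<gamma>)"
      unfolding wasserstein2_def coupling_cost_def by (rule INF_lower)
    then have "(wasserstein2 M N)\<^sup>2 \<le> (ennreal_sqrt (coupling_cost \<gamma>))\<^sup>2"
      by (rule power_mono) simp
    then show "(wasserstein2 M N)\<^sup>2 \<le> coupling_cost \<gamma>" by simp
  qed
  have "ennreal_sqrt (INF \<gamma>\<in>couplings M N. coupling_cost \<gamma>) \<le> wasserstein2 M N"
    unfolding wasserstein2_def coupling_cost_def[symmetric]
    by (intro INF_greatest ennreal_sqrt_mono INF_lower)
  then have "(ennreal_sqrt (INF \<gamma>\<in>couplings M N. coupling_cost \<gamma>))\<^sup>2 \<le> (wasserstein2 M N)\<^sup>2"
    by (rule power_mono) simp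
  then show "(INF \<gamma>\<in>couplings M N. coupling_cost \<gamma>) \<le> (wasserstein2 M N)\<^sup>2" by simp
qed

abbreviation density_measure :: "('a::euclidean_space \<Rightarrow> real) \<Rightarrow> 'a measure" where
  "density_measure q \<equiv> density lborel (\<lambda>x. ennreal (q x))"

lemma wasserstein_loss_eq:
  "wasserstein_loss \<sigma> \<mu> q =
    (INF \<gamma>\<in>couplings (density_measure (mvn_density \<sigma> \<mu>)) (density_measure q). coupling_cost \<gamma>)"
  by (simp add: wasserstein_loss_def wasserstein2_power2)

definition second_moment :: "('a::euclidean_space \<Rightarrow> real) \<Rightarrow> ennreal" where
  "second_moment q = (\<integral>\<^sup>+ y. ennreal (q y) * ennreal ((norm y)\<^sup>2) \<partial>lborel)"

text \<open>A Bochner integral, hence 0 when the first moment does not exist; it is read as a mean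
  only under a finite \<open>second_moment\<close>.\<close>

definition pdf_mean :: "('a::euclidean_space \<Rightarrow> real) \<Rightarrow> 'a" where
  "pdf_mean q = (\<integral>y. q y *\<^sub>R y \<partial>lborel)"

lemma second_moment_mvn_density:
  fixes \<mu> :: "'a::euclidean_space"
  assumes "\<sigma> > 0"
  shows "second_moment (mvn_density \<sigma> \<mu>) < \<infinity>"
proof -
  have "second_moment (mvn_density \<sigma> \<mu>) = ennreal (\<integral>x. (norm (x - 0))\<^sup>2 * mvn_density \<sigma> \<mu> x \<partial>lborel)"
    unfolding second_moment_def
    by (subst nn_integral_eq_integral[symmetric, OF integrable_mvn_density_norm_sq[OF assms]])
       (auto simp: ennreal_mult mult.commute)
  then show ?thesis by simp
qed

lemma integrable_pdf_mean:
  fixes q :: "'a::euclidean_space \<Rightarrow> real"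
  assumes q: "is_pdf q" and "second_moment q < \<infinity>"
  shows "integrable lborel (\<lambda>y. q y *\<^sub>R y)"
proof -
  have [measurable]: "q \<in> borel_measurable borel" and nn: "0 \<le> q y" for y
    using q by (auto simp: is_pdf_def)
  have 1: "integrable lborel q"
    using q by (intro integrableI_nonneg) (auto simp: is_pdf_def)
  have 2: "integrable lborel (\<lambda>y. q y * (norm y)\<^sup>2)"
    using assms(2) nn by (intro integrableI_nonneg) (auto simp: second_moment_def ennreal_mult)
  show ?thesis
  proof (rule Bochner_Integration.integrable_bound[OF Bochner_Integration.integrable_add[OF 1 2]])
    show "AE y in lborel. norm (q y *\<^sub>R y) \<le> norm (q y + q y * (norm y)\<^sup>2)"
    proof (rule AE_I2)
      fix y :: 'a
      have "norm y \<le> 1 + (norm y)\<^sup>2"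
        using zero_le_power2[of "norm y - 1/2"] by (simp add: power2_eq_square algebra_simps)
      from mult_left_mono[OF this nn[of y]] show "norm (q y *\<^sub>R y) \<le> norm (q y + q y * (norm y)\<^sup>2)"
        using nn[of y] by (simp add: distrib_left)
    qed
  qed measurable
qed

lemma pdf_mean_inner:
  assumes "is_pdf q" "second_moment q < \<infinity>"
  shows "(\<integral>y. q y * (y \<bullet> c) \<partial>lborel) = pdf_mean q \<bullet> c"
  using integral_inner_left[of c, OF integrable_pdf_mean[OF assms]] by (simp add: pdf_mean_def)

lemma pdf_mean_mvn_density:
  fixes \<mu> :: "'a::euclidean_space"
  assumes "\<sigma> > 0"
  shows "pdf_mean (mvn_density \<sigma> \<mu>) = \<mu>"
proof (rule euclidean_eqI)
  fix b :: 'a assume "b \<in> Basis"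
  note pdf = is_pdf_mvn_density[OF assms, of \<mu>]
  have int: "integrable lborel (\<lambda>x. mvn_density \<sigma> \<mu> x * (x \<bullet> b))"
    using integrable_inner_left[of b, OF integrable_pdf_mean[OF pdf second_moment_mvn_density[OF assms]]]
    by simp
  have "0 = (\<integral>x. ((x - \<mu>) \<bullet> b) * mvn_density \<sigma> \<mu> x \<partial>lborel)"
    by (simp add: integral_mvn_density_inner[OF assms])
  also have "\<dots> = (\<integral>x. mvn_density \<sigma> \<mu> x * (x \<bullet> b) - (\<mu> \<bullet> b) * mvn_density \<sigma> \<mu> x \<partial>lborel)"
    by (intro Bochner_Integration.integral_cong) (auto simp: inner_diff_left algebra_simps)
  also have "\<dots> = pdf_mean (mvn_density \<sigma> \<mu>) \<bullet> b - \<mu> \<bullet> b"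
    using int assms by (simp add: pdf_mean_inner[OF pdf second_moment_mvn_density[OF assms]])
  finally show "pdf_mean (mvn_density \<sigma> \<mu>) \<bullet> b = \<mu> \<bullet> b" by simp
qed

lemma couplings_sets: "\<gamma> \<in> couplings M N \<Longrightarrow> sets \<gamma> = sets (borel \<Otimes>\<^sub>M borel)"
  by (simp add: couplings_def)

lemma couplings_nn_integral:
  assumes \<gamma>: "\<gamma> \<in> couplings M N" and [measurable]: "f \<in> borel_measurable borel"
  shows "(\<integral>\<^sup>+ z. f (fst z) \<partial>\<gamma>) = (\<integral>\<^sup>+ x. f x \<partial>M)" "(\<integral>\<^sup>+ z. f (snd z) \<partial>\<gamma>) = (\<integral>\<^sup>+ x. f x \<partial>N)"
proof -
  note [measurable_cong] = couplings_sets[OF \<gamma>]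
  have "M = distr \<gamma> borel fst" "N = distr \<gamma> borel snd"
    using \<gamma> by (simp_all add: couplings_def)
  then show "(\<integral>\<^sup>+ z. f (fst z) \<partial>\<gamma>) = (\<integral>\<^sup>+ x. f x \<partial>M)" "(\<integral>\<^sup>+ z. f (snd z) \<partial>\<gamma>) = (\<integral>\<^sup>+ x. f x \<partial>N)"
    by (simp_all add: nn_integral_distr)
qed

lemma couplings_integral:
  fixes f :: "'a::euclidean_space \<Rightarrow> real"
  assumes \<gamma>: "\<gamma> \<in> couplings M N" and [measurable]: "f \<in> borel_measurable borel"
  shows "integrable \<gamma> (\<lambda>z. f (fst z)) \<longleftrightarrow> integrable M f" "integrable \<gamma> (\<lambda>z. f (snd z)) \<longleftrightarrow> integrable N f"
    "(\<integral>z. f (fst z) \<partial>\<gamma>) = (\<integral>x. f x \<partial>M)" "(\<integral>z. f (snd z) \<partial>\<gamma>) = (\<integral>x. f x \<partial>N)"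
proof -
  note [measurable_cong] = couplings_sets[OF \<gamma>]
  have "M = distr \<gamma> borel fst" "N = distr \<gamma> borel snd"
    using \<gamma> by (simp_all add: couplings_def)
  then show "integrable \<gamma> (\<lambda>z. f (fst z)) \<longleftrightarrow> integrable M f" "integrable \<gamma> (\<lambda>z. f (snd z)) \<longleftrightarrow> integrable N f"
    "(\<integral>z. f (fst z) \<partial>\<gamma>) = (\<integral>x. f x \<partial>M)" "(\<integral>z. f (snd z) \<partial>\<gamma>) = (\<integral>x. f x \<partial>N)"
    by (simp_all add: integral_distr integrable_distr_eq)
qed

lemma integrable_density_measure_norm_sq:
  assumes q: "is_pdf q" and "second_moment q < \<infinity>"
  shows "integrable (density_measure q) (\<lambda>y. (norm y)\<^sup>2)"
proof -
  have [measurable]: "q \<in> borel_measurable borel" and nn: "0 \<le> q y" for y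
    using q by (auto simp: is_pdf_def)
  show ?thesis
    using assms(2) by (intro integrableI_nonneg) (auto simp: second_moment_def nn_integral_density)
qed

lemma integral_density_measure_inner:
  assumes q: "is_pdf q" and "second_moment q < \<infinity>"
  shows "integrable (density_measure q) (\<lambda>y. y \<bullet> c)"
    "(\<integral>y. y \<bullet> c \<partial>density_measure q) = pdf_mean q \<bullet> c"
proof -
  have [measurable]: "q \<in> borel_measurable borel" and nn: "0 \<le> q y" for y
    using q by (auto simp: is_pdf_def)
  show "integrable (density_measure q) (\<lambda>y. y \<bullet> c)"
    using integrable_inner_left[of c, OF integrable_pdf_mean[OF assms]] nn
    by (simp add: integrable_density)
  show "(\<integral>y. y \<bullet> c \<partial>density_measure q) = pdf_mean q \<bullet> c"
    using nn by (simp add: integral_density pdf_mean_inner[OF assms])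
qed

lemma distr_density_measure_mvn:
  fixes a c :: "'a::euclidean_space"
  shows "distr (density_measure (mvn_density \<sigma> a)) borel (\<lambda>x. x + c) =
    density_measure (mvn_density \<sigma> (a + c))"
proof -
  have plus_fun_eq: "(+) c = (\<lambda>x. x + c)"
    by (auto simp: add.commute)
  have "density_measure (mvn_density \<sigma> (a + c)) =
      density (distr lborel borel ((+) c)) (\<lambda>x. ennreal (mvn_density \<sigma> (a + c) x))"
    by (simp add: lborel_distr_plus)
  also have "\<dots> = distr (density lborel (\<lambda>x. ennreal (mvn_density \<sigma> (a + c) (c + x)))) borel ((+) c)"
    by (rule density_distr) auto
  also have "\<dots> = distr (density_measure (mvn_density \<sigma> a)) borel (\<lambda>x. x + c)"
    by (simp add: mvn_density_def add.commute[of c] plus_fun_eq)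
  finally show ?thesis by simp
qed

text \<open>Shifting the first component by \<open>e = b - a\<close> changes the cost by
  \<open>2 (a - m) . e + |e|^2\<close>, with \<open>m\<close> the mean of \<open>q\<close>. The
  cross term depends only on the marginal means, so the change is the same for every coupling. Sums
  on both sides avoid the truncated subtraction of \<open>ennreal\<close>.\<close>

lemma coupling_translate:
  fixes a b :: "'a::euclidean_space"
  assumes "\<sigma> > 0" and q: "is_pdf q" and fin: "second_moment q < \<infinity>"
    and \<gamma>: "\<gamma> \<in> couplings (density_measure (mvn_density \<sigma> a)) (density_measure q)"
  obtains \<gamma>' where "\<gamma>' \<in> couplings (density_measure (mvn_density \<sigma> b)) (density_measure q)"
    "coupling_cost \<gamma> + ennreal ((norm (b - pdf_mean q))\<^sup>2) =
     coupling_cost \<gamma>' + ennreal ((norm (a - pdf_mean q))\<^sup>2)"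
proof -
  note s [measurable_cong] = couplings_sets[OF \<gamma>]
  define e where "e = b - a"
  define m where "m = pdf_mean q"
  let ?D = "\<lambda>z::'a \<times> 'a. fst z - snd z"
  define \<gamma>' where "\<gamma>' = distr \<gamma> (borel \<Otimes>\<^sub>M borel) (\<lambda>z. (fst z + e, snd z))"
  have "\<gamma>' \<in> couplings (density_measure (mvn_density \<sigma> b)) (density_measure q)"
  proof -
    have "distr \<gamma>' borel fst = distr (distr \<gamma> borel fst) borel (\<lambda>x. x + e)"
      unfolding \<gamma>'_def by (simp add: distr_distr comp_def)
    also have "\<dots> = density_measure (mvn_density \<sigma> b)"
      using \<gamma> by (simp add: couplings_def distr_density_measure_mvn e_def)
    finally have "distr \<gamma>' borel fst = density_measure (mvn_density \<sigma> b)" .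
    moreover have "distr \<gamma>' borel snd = distr \<gamma> borel snd"
      unfolding \<gamma>'_def by (simp add: distr_distr comp_def)
    ultimately show ?thesis
      using \<gamma> by (simp add: couplings_def \<gamma>'_def)
  qed
  moreover have "coupling_cost \<gamma> + ennreal ((norm (b - m))\<^sup>2) = coupling_cost \<gamma>' + ennreal ((norm (a - m))\<^sup>2)"
  proof -
    note pdf = is_pdf_mvn_density[OF assms(1), of a] and sm = second_moment_mvn_density[OF assms(1), of a]
    have "emeasure \<gamma> (space \<gamma>) = 1"
      using couplings_nn_integral(2)[OF \<gamma>, of "\<lambda>_. 1"] q
      by (simp add: is_pdf_def emeasure_density)
    then interpret prob_space \<gamma> by (rule prob_spaceI)
    have iD: "integrable \<gamma> (\<lambda>z. ?D z \<bullet> e)"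
      using couplings_integral(1)[OF \<gamma>, of "\<lambda>x. x \<bullet> e"] couplings_integral(2)[OF \<gamma>, of "\<lambda>x. x \<bullet> e"]
        integral_density_measure_inner(1)[OF pdf sm] integral_density_measure_inner(1)[OF q fin]
      by (simp add: inner_diff_left)
    have mD: "(\<integral>z. ?D z \<bullet> e \<partial>\<gamma>) = (a - m) \<bullet> e"
      using couplings_integral[OF \<gamma>, of "\<lambda>x. x \<bullet> e"]
        integral_density_measure_inner[OF pdf sm] integral_density_measure_inner[OF q fin]
      by (simp add: inner_diff_left pdf_mean_mvn_density[OF assms(1)] m_def)
    have iD2: "integrable \<gamma> (\<lambda>z. (norm (?D z))\<^sup>2)"
    proof (rule Bochner_Integration.integrable_bound)
      show "integrable \<gamma> (\<lambda>z. 2 * (norm (fst z))\<^sup>2 + 2 * (norm (snd z))\<^sup>2)"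
        using couplings_integral(1,2)[OF \<gamma>, of "\<lambda>x. (norm x)\<^sup>2"]
          integrable_density_measure_norm_sq[OF pdf sm] integrable_density_measure_norm_sq[OF q fin]
        by simp
      show "AE z in \<gamma>. norm ((norm (?D z))\<^sup>2) \<le> norm (2 * (norm (fst z))\<^sup>2 + 2 * (norm (snd z))\<^sup>2)"
      proof (rule AE_I2)
        fix z :: "'a \<times> 'a"
        have "(norm (?D z))\<^sup>2 \<le> (norm (fst z) + norm (snd z))\<^sup>2"
          by (intro power_mono norm_triangle_ineq4) simp
        also have "\<dots> \<le> 2 * (norm (fst z))\<^sup>2 + 2 * (norm (snd z))\<^sup>2"
          using zero_le_power2[of "norm (fst z) - norm (snd z)"] by (simp add: power2_eq_square algebra_simps)
        finally show "norm ((norm (?D z))\<^sup>2) \<le> norm (2 * (norm (fst z))\<^sup>2 + 2 * (norm (snd z))\<^sup>2)"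
          by simp
      qed
    qed measurable
    have sq: "(norm (?D z + e))\<^sup>2 = (norm (?D z))\<^sup>2 + 2 * (?D z \<bullet> e) + (norm e)\<^sup>2" for z
      unfolding power2_norm_eq_inner by (simp add: inner_add_left inner_add_right inner_commute)
    have iDe: "integrable \<gamma> (\<lambda>z. (norm (?D z + e))\<^sup>2)"
      unfolding sq using iD iD2 by simp
    have "coupling_cost \<gamma>' = (\<integral>\<^sup>+ z. ennreal ((norm (?D z + e))\<^sup>2) \<partial>\<gamma>)"
      unfolding coupling_cost_def \<gamma>'_def
      by (subst nn_integral_distr) (auto simp: algebra_simps)
    also have "\<dots> = ennreal (\<integral>z. (norm (?D z + e))\<^sup>2 \<partial>\<gamma>)"
      using iDe by (intro nn_integral_eq_integral) auto
    also have "(\<integral>z. (norm (?D z + e))\<^sup>2 \<partial>\<gamma>) = (\<integral>z. (norm (?D z))\<^sup>2 \<partial>\<gamma>) + 2 * ((a - m) \<bullet> e) + (norm e)\<^sup>2"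
      unfolding sq using iD iD2 by (simp add: mD prob_space)
    finally have c': "coupling_cost \<gamma>' =
      ennreal ((\<integral>z. (norm (?D z))\<^sup>2 \<partial>\<gamma>) + 2 * ((a - m) \<bullet> e) + (norm e)\<^sup>2)" .
    have nn: "0 \<le> (\<integral>z. (norm (?D z))\<^sup>2 \<partial>\<gamma>) + 2 * ((a - m) \<bullet> e) + (norm e)\<^sup>2"
      using \<open>(\<integral>z. (norm (?D z + e))\<^sup>2 \<partial>\<gamma>) = (\<integral>z. (norm (?D z))\<^sup>2 \<partial>\<gamma>) + 2 * ((a - m) \<bullet> e) + (norm e)\<^sup>2\<close>
        integral_nonneg_AE[of "\<lambda>z. (norm (?D z + e))\<^sup>2" \<gamma>] by simp
    have c: "coupling_cost \<gamma> = ennreal (\<integral>z. (norm (?D z))\<^sup>2 \<partial>\<gamma>)"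
      unfolding coupling_cost_def using iD2 by (intro nn_integral_eq_integral) auto
    have bm: "(norm (b - m))\<^sup>2 = (norm (a - m))\<^sup>2 + 2 * ((a - m) \<bullet> e) + (norm e)\<^sup>2"
      unfolding power2_norm_eq_inner e_def
      by (simp add: inner_diff_left inner_diff_right inner_commute algebra_simps)
    have "coupling_cost \<gamma> + ennreal ((norm (b - m))\<^sup>2) =
        ennreal ((\<integral>z. (norm (?D z))\<^sup>2 \<partial>\<gamma>) + (norm (b - m))\<^sup>2)"
      unfolding c by (rule ennreal_plus[symmetric]) (simp_all add: integral_nonneg_AE)
    also have "\<dots> = ennreal (((\<integral>z. (norm (?D z))\<^sup>2 \<partial>\<gamma>) + 2 * ((a - m) \<bullet> e) + (norm e)\<^sup>2) + (norm (a - m))\<^sup>2)"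
      unfolding bm by (simp only: add_ac)
    also have "\<dots> = coupling_cost \<gamma>' + ennreal ((norm (a - m))\<^sup>2)"
      unfolding c' by (rule ennreal_plus) (use nn in simp_all)
    finally show ?thesis .
  qed
  ultimately show thesis
    using that m_def by blast
qed

text \<open>Translating the Gaussian marginal of a coupling splits the squared mean difference off the
  transport cost.\<close>

lemma wasserstein_loss_decomp:
  fixes \<mu> :: "'a::euclidean_space"
  assumes "\<sigma> > 0" "is_pdf q" "second_moment q < \<infinity>"
  shows "wasserstein_loss \<sigma> \<mu> q =
    ennreal ((norm (\<mu> - pdf_mean q))\<^sup>2) + wasserstein_loss \<sigma> (pdf_mean q) q"
proof (rule antisym)
  show "wasserstein_loss \<sigma> \<mu> q \<le> ennreal ((norm (\<mu> - pdf_mean q))\<^sup>2) + wasserstein_loss \<sigma> (pdf_mean q) q"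
  proof -
    \<comment> \<open>Moving the finite squared distance to the left leaves a bare infimum on the
      right, so that couplings can be treated one at a time.\<close>
    have "wasserstein_loss \<sigma> \<mu> q - ennreal ((norm (\<mu> - pdf_mean q))\<^sup>2) \<le> wasserstein_loss \<sigma> (pdf_mean q) q"
      unfolding wasserstein_loss_eq[of _ "pdf_mean q"]
    proof (rule INF_greatest)
      fix \<gamma> assume "\<gamma> \<in> couplings (density_measure (mvn_density \<sigma> (pdf_mean q))) (density_measure q)"
      from coupling_translate[OF assms this, of \<mu>] obtain \<gamma>'
        where \<gamma>': "\<gamma>' \<in> couplings (density_measure (mvn_density \<sigma> \<mu>)) (density_measure q)"
          "coupling_cost \<gamma> + ennreal ((norm (\<mu> - pdf_mean q))\<^sup>2) = coupling_cost \<gamma>'"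
        by auto
      have "wasserstein_loss \<sigma> \<mu> q \<le> coupling_cost \<gamma>'"
        unfolding wasserstein_loss_eq by (rule INF_lower[OF \<gamma>'(1)])
      then show "wasserstein_loss \<sigma> \<mu> q - ennreal ((norm (\<mu> - pdf_mean q))\<^sup>2) \<le> coupling_cost \<gamma>"
        unfolding \<gamma>'(2)[symmetric] by (simp add: ennreal_minus_le_iff add.commute)
    qed
    then show ?thesis
      by (simp add: ennreal_minus_le_iff)
  qed
  show "ennreal ((norm (\<mu> - pdf_mean q))\<^sup>2) + wasserstein_loss \<sigma> (pdf_mean q) q \<le> wasserstein_loss \<sigma> \<mu> q"
    unfolding wasserstein_loss_eq[of _ \<mu>]
  proof (rule INF_greatest)
    fix \<gamma> assume "\<gamma> \<in> couplings (density_measure (mvn_density \<sigma> \<mu>)) (density_measure q)"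
    from coupling_translate[OF assms this, of "pdf_mean q"] obtain \<gamma>'
      where \<gamma>': "\<gamma>' \<in> couplings (density_measure (mvn_density \<sigma> (pdf_mean q))) (density_measure q)"
        "coupling_cost \<gamma> = coupling_cost \<gamma>' + ennreal ((norm (\<mu> - pdf_mean q))\<^sup>2)"
      by auto
    have "wasserstein_loss \<sigma> (pdf_mean q) q \<le> coupling_cost \<gamma>'"
      unfolding wasserstein_loss_eq by (rule INF_lower[OF \<gamma>'(1)])
    then show "ennreal ((norm (\<mu> - pdf_mean q))\<^sup>2) + wasserstein_loss \<sigma> (pdf_mean q) q \<le> coupling_cost \<gamma>"
      unfolding \<gamma>'(2) by (simp add: add.commute add_mono)
  qed
qed

text \<open>From \<open>|y|^2 \<le> 2 |x|^2 + 2 |x - y|^2\<close> and the finite second moment of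
  the Gaussian, every coupling with \<open>q\<close> has infinite cost.\<close>

lemma wasserstein_loss_infinite:
  fixes \<mu> :: "'a::euclidean_space"
  assumes "\<sigma> > 0" "is_pdf q" "second_moment q = \<infinity>"
  shows "wasserstein_loss \<sigma> \<mu> q = \<infinity>"
proof -
  have "coupling_cost \<gamma> = \<infinity>"
    if \<gamma>: "\<gamma> \<in> couplings (density_measure (mvn_density \<sigma> \<mu>)) (density_measure q)" for \<gamma>
  proof -
    note [measurable_cong] = couplings_sets[OF \<gamma>]
    have [measurable]: "q \<in> borel_measurable borel"
      using assms(2) by (simp add: is_pdf_def)
    have "second_moment q = (\<integral>\<^sup>+ z. ennreal ((norm (snd z))\<^sup>2) \<partial>\<gamma>)"
      using couplings_nn_integral(2)[OF \<gamma>, of "\<lambda>x. ennreal ((norm x)\<^sup>2)"]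
      by (simp add: second_moment_def nn_integral_density)
    also have "\<dots> \<le> (\<integral>\<^sup>+ z. 2 * ennreal ((norm (fst z))\<^sup>2) + 2 * ennreal ((norm (fst z - snd z))\<^sup>2) \<partial>\<gamma>)"
    proof (rule nn_integral_mono)
      fix z :: "'a \<times> 'a"
      have "(norm (snd z))\<^sup>2 \<le> (norm (fst z) + norm (fst z - snd z))\<^sup>2"
        using norm_triangle_ineq4[of "fst z" "fst z - snd z"] by (intro power_mono) auto
      also have "\<dots> \<le> 2 * (norm (fst z))\<^sup>2 + 2 * (norm (fst z - snd z))\<^sup>2"
        using zero_le_power2[of "norm (fst z) - norm (fst z - snd z)"]
        by (simp add: power2_eq_square algebra_simps)
      finally have "ennreal ((norm (snd z))\<^sup>2) \<le> ennreal (2 * (norm (fst z))\<^sup>2 + 2 * (norm (fst z - snd z))\<^sup>2)"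
        by (rule ennreal_leI)
      then show "ennreal ((norm (snd z))\<^sup>2) \<le>
        2 * ennreal ((norm (fst z))\<^sup>2) + 2 * ennreal ((norm (fst z - snd z))\<^sup>2)"
        by (simp add: ennreal_mult)
    qed
    also have "\<dots> = 2 * second_moment (mvn_density \<sigma> \<mu>) + 2 * coupling_cost \<gamma>"
      using couplings_nn_integral(1)[OF \<gamma>, of "\<lambda>x. ennreal ((norm x)\<^sup>2)"]
      by (simp add: nn_integral_add nn_integral_cmult coupling_cost_def second_moment_def nn_integral_density)
    finally have "2 * second_moment (mvn_density \<sigma> \<mu>) + 2 * coupling_cost \<gamma> = \<infinity>"
      using assms(3) by (simp add: top_unique)
    then show ?thesis
      using second_moment_mvn_density[OF assms(1), of \<mu>]
      by (auto simp: ennreal_mult_eq_top_iff)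
  qed
  then show ?thesis
    unfolding wasserstein_loss_eq by (intro antisym INF_greatest) auto
qed

text \<open>The diagonal coupling gives loss 0 for equal centres; the decomposition then yields the
  general case.\<close>

lemma wasserstein_loss_mvn_density:
  fixes \<mu> \<nu> :: "'a::euclidean_space"
  assumes "\<sigma> > 0"
  shows "wasserstein_loss \<sigma> \<mu> (mvn_density \<sigma> \<nu>) = ennreal ((norm (\<mu> - \<nu>))\<^sup>2)"
proof -
  let ?M = "density_measure (mvn_density \<sigma> \<nu>)"
  let ?\<gamma> = "distr ?M (borel \<Otimes>\<^sub>M borel) (\<lambda>x. (x, x))"
  have "distr ?M borel (\<lambda>x. x) = ?M"
    by (rule distr_id2) simp
  then have "?\<gamma> \<in> couplings ?M ?M"
    by (simp add: couplings_def distr_distr comp_def)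
  then have "wasserstein_loss \<sigma> \<nu> (mvn_density \<sigma> \<nu>) \<le> coupling_cost ?\<gamma>"
    unfolding wasserstein_loss_eq by (rule INF_lower)
  also have "\<dots> = 0"
    by (simp add: coupling_cost_def nn_integral_distr)
  finally show ?thesis
    using wasserstein_loss_decomp[OF assms is_pdf_mvn_density[OF assms] second_moment_mvn_density[OF assms], of \<mu> \<nu>]
    by (simp add: pdf_mean_mvn_density[OF assms])
qed

section \<open>The minimax lower bound\<close>

text \<open>The mean squared distance to \<open>c\<close> exceeds the variance by
  \<open>|\<nu> - c|^2\<close>, because the cross term integrates to zero.\<close>

lemma mvn_density_second_moment_ge:
  fixes \<sigma> :: real and \<nu> c :: "'a::euclidean_space"
  assumes "\<sigma> > 0"
  shows "ennreal (DIM('a) * \<sigma>\<^sup>2) \<le>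
    (\<integral>\<^sup>+ \<mu>. ennreal ((norm (\<mu> - c))\<^sup>2) * ennreal (mvn_density \<sigma> \<nu> \<mu>) \<partial>lborel)"
proof -
  let ?p = "mvn_density \<sigma> \<nu>"
  have i1: "integrable lborel (\<lambda>x. (norm (x - \<nu>))\<^sup>2 * ?p x)"
    and i2: "integrable lborel (\<lambda>x. (norm (x - c))\<^sup>2 * ?p x)"
    by (rule integrable_mvn_density_norm_sq[OF assms])+
  have pw: "((x - \<nu>) \<bullet> (2 *\<^sub>R (\<nu> - c))) * ?p x =
      (norm (x - c))\<^sup>2 * ?p x - (norm (x - \<nu>))\<^sup>2 * ?p x - (norm (\<nu> - c))\<^sup>2 * ?p x" for x
    unfolding power2_norm_eq_inner
    by (simp add: inner_diff_left inner_diff_right inner_commute algebra_simps)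
  have "0 = (\<integral>x. ((x - \<nu>) \<bullet> (2 *\<^sub>R (\<nu> - c))) * ?p x \<partial>lborel)"
    by (simp only: integral_mvn_density_inner[OF assms])
  also have "\<dots> = (\<integral>x. (norm (x - c))\<^sup>2 * ?p x \<partial>lborel) - DIM('a) * \<sigma>\<^sup>2 - (norm (\<nu> - c))\<^sup>2"
    unfolding pw using i1 i2 assms by (simp add: integral_mvn_density_norm_sq)
  finally have "DIM('a) * \<sigma>\<^sup>2 \<le> (\<integral>x. (norm (x - c))\<^sup>2 * ?p x \<partial>lborel)"
    by (smt (verit) zero_le_power2)
  then have "ennreal (DIM('a) * \<sigma>\<^sup>2) \<le> ennreal (\<integral>x. (norm (x - c))\<^sup>2 * ?p x \<partial>lborel)"
    by (rule ennreal_leI)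
  also have "\<dots> = (\<integral>\<^sup>+ \<mu>. ennreal ((norm (\<mu> - c))\<^sup>2) * ennreal (?p \<mu>) \<partial>lborel)"
    using i2 by (simp add: nn_integral_eq_integral[symmetric] ennreal_mult)
  finally show ?thesis .
qed

text \<open>Averaging the risk over the prior \<open>N(0, \<tau>\<^sup>2 I)\<close> bounds it below by the posterior variance
  \<open>d \<sigma>\<^sup>2 \<tau>\<^sup>2 / (\<sigma>\<^sup>2 + \<tau>\<^sup>2)\<close>; then \<open>\<tau> \<rightarrow> \<infinity>\<close>.\<close>

lemma risk_lower_bound:
  fixes \<sigma> :: real and q :: "'a::euclidean_space \<Rightarrow> 'a \<Rightarrow> real"
  assumes "\<sigma> > 0" and q: "predictive_density q"
  shows "ennreal (DIM('a) * \<sigma>\<^sup>2) \<le> (SUP \<mu>. risk \<sigma> \<mu> q)"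
proof -
  define R where "R = (SUP \<mu>. risk \<sigma> \<mu> q)"
  have pdf: "is_pdf (q x)" for x
    using q by (simp add: predictive_density_def)
  have "(\<lambda>(x, y). q x y) \<in> borel_measurable (borel \<Otimes>\<^sub>M borel)"
    using q by (simp add: predictive_density_def)
  then have [measurable]: "(\<lambda>(x, y). q x y) \<in> borel_measurable (borel \<Otimes>\<^sub>M lborel)"
    by (simp cong: measurable_cong_sets sets_pair_measure_cong)
  have [measurable]: "(\<lambda>x. second_moment (q x)) \<in> borel_measurable borel"
    unfolding second_moment_def by measurable
  have [measurable]: "(\<lambda>x. pdf_mean (q x)) \<in> borel_measurable borel"
    unfolding pdf_mean_def by measurable
  \<comment> \<open>A minorant of the loss that is visibly jointly measurable, so that the order of
    integration can be exchanged. Where the second moment is infinite it equals the loss.\<close>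
  define h where "h \<mu> x = (if second_moment (q x) < \<infinity>
    then ennreal ((norm (\<mu> - pdf_mean (q x)))\<^sup>2) else \<infinity>)" for \<mu> x
  have [measurable]: "(\<lambda>(\<mu>, x). h \<mu> x) \<in> borel_measurable (borel \<Otimes>\<^sub>M borel)"
    unfolding h_def by measurable
  have h_le: "h \<mu> x \<le> wasserstein_loss \<sigma> \<mu> (q x)" for \<mu> x
    using wasserstein_loss_decomp[OF assms(1) pdf[of x], of \<mu>]
      wasserstein_loss_infinite[OF assms(1) pdf[of x], of \<mu>]
    by (auto simp: h_def less_top[symmetric])
  have hR: "(\<integral>\<^sup>+ x. h \<mu> x * ennreal (mvn_density \<sigma> \<mu> x) \<partial>lborel) \<le> R" for \<mu>
  proof -
    have "(\<integral>\<^sup>+ x. h \<mu> x * ennreal (mvn_density \<sigma> \<mu> x) \<partial>lborel) \<le> risk \<sigma> \<mu> q"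
      unfolding risk_def by (intro nn_integral_mono mult_right_mono h_le) simp
    also have "\<dots> \<le> R"
      unfolding R_def by (rule SUP_upper) simp
    finally show ?thesis .
  qed
  have avg: "ennreal (DIM('a) * (\<sigma> * \<tau> / sqrt (\<sigma>\<^sup>2 + \<tau>\<^sup>2))\<^sup>2) \<le> R" if \<tau>: "\<tau> > 0" for \<tau>
  proof -
    define \<rho> where "\<rho> = sqrt (\<sigma>\<^sup>2 + \<tau>\<^sup>2)"
    define s where "s = \<sigma> * \<tau> / \<rho>"
    have \<rho>: "\<rho> > 0" using assms(1) by (simp add: \<rho>_def add_pos_nonneg)
    then have s: "s > 0" using assms(1) \<tau> by (simp add: s_def)
    \<comment> \<open>The posterior mean under the prior centred at 0, left unsimplified to match
      \<open>mvn_density_mult\<close> literally.\<close>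
    let ?c = "\<lambda>x::'a. 0 + (\<tau>\<^sup>2 / \<rho>\<^sup>2) *\<^sub>R (x - 0)"
    have "ennreal (DIM('a) * s\<^sup>2) =
        (\<integral>\<^sup>+ x. ennreal (DIM('a) * s\<^sup>2) * ennreal (mvn_density \<rho> 0 (x::'a)) \<partial>lborel)"
      by (simp add: nn_integral_cmult nn_integral_mvn_density[OF \<rho>])
    also have "\<dots> \<le> (\<integral>\<^sup>+ x. (\<integral>\<^sup>+ \<mu>. h \<mu> x * ennreal (mvn_density s (?c x) \<mu>) \<partial>lborel) *
        ennreal (mvn_density \<rho> 0 x) \<partial>lborel)"
    proof (intro nn_integral_mono mult_right_mono)
      fix x :: 'a
      show "ennreal (DIM('a) * s\<^sup>2) \<le> (\<integral>\<^sup>+ \<mu>. h \<mu> x * ennreal (mvn_density s (?c x) \<mu>) \<partial>lborel)"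
      proof (cases "second_moment (q x) < \<infinity>")
        case True
        then show ?thesis
          unfolding h_def using mvn_density_second_moment_ge[OF s] by simp
      next
        case False
        then have "(\<integral>\<^sup>+ \<mu>. h \<mu> x * ennreal (mvn_density s (?c x) \<mu>) \<partial>lborel) = \<infinity>"
          unfolding h_def by (simp add: nn_integral_cmult nn_integral_mvn_density[OF s])
        then show ?thesis by simp
      qed
    qed simp
    also have "\<dots> = (\<integral>\<^sup>+ x. (\<integral>\<^sup>+ \<mu>. h \<mu> x * ennreal (mvn_density \<sigma> \<mu> x) * ennreal (mvn_density \<tau> 0 \<mu>) \<partial>lborel) \<partial>lborel)"
    proof (rule nn_integral_cong)
      fix x :: 'a
      have "h \<mu> x * ennreal (mvn_density \<sigma> \<mu> x) * ennreal (mvn_density \<tau> 0 \<mu>) =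
          h \<mu> x * ennreal (mvn_density s (?c x) \<mu>) * ennreal (mvn_density \<rho> 0 x)" for \<mu>
      proof -
        have "ennreal (mvn_density \<sigma> \<mu> x) * ennreal (mvn_density \<tau> 0 \<mu>) =
            ennreal (mvn_density s (?c x) \<mu>) * ennreal (mvn_density \<rho> 0 x)"
          using mvn_density_mult[OF assms(1) \<tau>, of \<mu> x 0]
          by (simp only: ennreal_mult[symmetric] mvn_density_nonneg \<rho>_def s_def mult.commute)
        then show ?thesis by (simp only: mult.assoc)
      qed
      then show "(\<integral>\<^sup>+ \<mu>. h \<mu> x * ennreal (mvn_density s (?c x) \<mu>) \<partial>lborel) * ennreal (mvn_density \<rho> 0 x) =
          (\<integral>\<^sup>+ \<mu>. h \<mu> x * ennreal (mvn_density \<sigma> \<mu> x) * ennreal (mvn_density \<tau> 0 \<mu>) \<partial>lborel)"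
        by (simp add: nn_integral_multc)
    qed
    also have "\<dots> = (\<integral>\<^sup>+ \<mu>. (\<integral>\<^sup>+ x. h \<mu> x * ennreal (mvn_density \<sigma> \<mu> x) * ennreal (mvn_density \<tau> 0 \<mu>) \<partial>lborel) \<partial>lborel)"
      by (rule lborel_pair.Fubini') measurable
    also have "\<dots> = (\<integral>\<^sup>+ \<mu>. (\<integral>\<^sup>+ x. h \<mu> x * ennreal (mvn_density \<sigma> \<mu> x) \<partial>lborel) * ennreal (mvn_density \<tau> 0 \<mu>) \<partial>lborel)"
      by (intro nn_integral_cong nn_integral_multc) measurable
    also have "\<dots> \<le> (\<integral>\<^sup>+ \<mu>. R * ennreal (mvn_density \<tau> 0 (\<mu>::'a)) \<partial>lborel)"
      by (intro nn_integral_mono mult_right_mono hR) simp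
    also have "\<dots> = R"
      by (simp add: nn_integral_cmult nn_integral_mvn_density[OF \<tau>])
    finally show ?thesis by (simp add: s_def \<rho>_def)
  qed
  have "ennreal (DIM('a) * \<sigma>\<^sup>2) \<le> R"
  proof (cases R)
    case (real r)
    have "DIM('a) * \<sigma>\<^sup>2 * \<tau>\<^sup>2 \<le> r * (\<sigma>\<^sup>2 + \<tau>\<^sup>2)" if "\<tau> > 0" for \<tau>
    proof -
      have "DIM('a) * (\<sigma> * \<tau> / sqrt (\<sigma>\<^sup>2 + \<tau>\<^sup>2))\<^sup>2 \<le> r"
        using avg[OF that] real by (simp add: ennreal_le_iff)
      moreover have "\<sigma>\<^sup>2 + \<tau>\<^sup>2 > 0"
        using assms(1) by (simp add: add_pos_nonneg)
      ultimately show ?thesis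
        by (simp add: power_divide power_mult_distrib pos_divide_le_eq mult.assoc)
    qed
    note le = this
    have "DIM('a) * \<sigma>\<^sup>2 \<le> r + e" if e: "e > 0" for e
    proof -
      \<comment> \<open>Chosen so that \<open>r * \<sigma>^2 \<le> e * \<tau>^2\<close>, which lets
        \<open>e\<close> absorb the deficit of the Gaussian prior; the summand 1 keeps \<tau>
        positive when \<open>r = 0\<close>.\<close>
      define \<tau> where "\<tau> = sqrt ((r * \<sigma>\<^sup>2 + 1) / e)"
      have pos: "(r * \<sigma>\<^sup>2 + 1) / e > 0"
        using real e by (intro divide_pos_pos add_nonneg_pos) auto
      then have t: "\<tau> > 0" "\<tau>\<^sup>2 = (r * \<sigma>\<^sup>2 + 1) / e"
        by (simp_all add: \<tau>_def)
      have "r * \<sigma>\<^sup>2 \<le> e * \<tau>\<^sup>2"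
        using e by (simp add: t)
      then have "DIM('a) * \<sigma>\<^sup>2 * \<tau>\<^sup>2 \<le> (r + e) * \<tau>\<^sup>2"
        using le[OF t(1)] by (simp add: algebra_simps)
      then show ?thesis
        by (rule mult_right_le_imp_le) (use t(1) in simp)
    qed
    then have "DIM('a) * \<sigma>\<^sup>2 \<le> r"
      by (rule field_le_epsilon)
    then show ?thesis
      using real by (simp add: ennreal_leI)
  qed simp
  then show ?thesis by (simp add: R_def)
qed

section \<open>Bayes predictive densities under a superharmonic prior\<close>

context superharmonic_model
begin

text \<open>The loss decomposition averaged over the posterior. The density \<open>q\<close> enters
  only through the distance of its mean from the posterior mean and its loss at its own mean; both
  vanish for the Gaussian at the posterior mean.\<close>

lemma posterior_loss_finite:
  assumes q: "is_pdf q" "second_moment q < \<infinity>"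
  shows "posterior_loss \<sigma> \<pi> x q =
    ennreal ((\<Sum>b\<in>Basis. post_var b x) + (norm (post_mean x - pdf_mean q))\<^sup>2) +
    wasserstein_loss \<sigma> (pdf_mean q) q"
proof -
  define v where "v = (\<Sum>b\<in>Basis. post_var b x)"
  define m where "m = pdf_mean q"
  define V where "V = wasserstein_loss \<sigma> m q"
  have v: "0 \<le> v" by (simp add: v_def sum_nonneg post_var_nonneg)
  note M = marginal_pos[of x]
  have "(\<integral>\<^sup>+ \<mu>. wasserstein_loss \<sigma> \<mu> q * (ennreal (mvn_density \<sigma> \<mu> x) * \<pi> \<mu>) \<partial>lborel) =
      (\<integral>\<^sup>+ \<mu>. (ennreal ((norm (\<mu> - m))\<^sup>2) + V) * (ennreal (mvn_density \<sigma> \<mu> x) * \<pi> \<mu>) \<partial>lborel)"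
  proof -
    have "wasserstein_loss \<sigma> \<mu> q = ennreal ((norm (\<mu> - m))\<^sup>2) + V" for \<mu>
      unfolding V_def m_def by (rule wasserstein_loss_decomp[OF sigma_pos q])
    then show ?thesis by (simp only:)
  qed
  also have "\<dots> = (\<integral>\<^sup>+ \<mu>. (ennreal ((norm (\<mu> - m))\<^sup>2) + V) * ennreal (weight x \<mu>) \<partial>lborel)"
    by (rule nn_integral_weight) measurable
  also have "\<dots> = (\<integral>\<^sup>+ \<mu>. ennreal ((norm (\<mu> - m))\<^sup>2 * weight x \<mu>) \<partial>lborel) + V * (\<integral>\<^sup>+ \<mu>. ennreal (weight x \<mu>) \<partial>lborel)"
    by (simp add: distrib_right nn_integral_add nn_integral_cmult ennreal_mult)
  also have "(\<integral>\<^sup>+ \<mu>. ennreal ((norm (\<mu> - m))\<^sup>2 * weight x \<mu>) \<partial>lborel) =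
      ennreal (v + (norm (post_mean x - m))\<^sup>2) * ennreal (marginal x)"
  proof -
    have "(\<integral>\<^sup>+ \<mu>. ennreal ((norm (\<mu> - m))\<^sup>2 * weight x \<mu>) \<partial>lborel) =
        ennreal (\<integral>\<mu>. (norm (\<mu> - m))\<^sup>2 * weight x \<mu> \<partial>lborel)"
      by (intro nn_integral_eq_integral integrable_weight_norm_sq) simp
    also have "\<dots> = ennreal ((v + (norm (post_mean x - m))\<^sup>2) * marginal x)"
      by (simp only: integral_weight_norm_sq v_def)
    also have "\<dots> = ennreal (v + (norm (post_mean x - m))\<^sup>2) * ennreal (marginal x)"
      using v M by (intro ennreal_mult) auto
    finally show ?thesis .
  qed
  also have "(\<integral>\<^sup>+ \<mu>. ennreal (weight x \<mu>) \<partial>lborel) = ennreal (marginal x)"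
    by (simp add: marginal_def nn_integral_eq_integral)
  finally have "posterior_loss \<sigma> \<pi> x q =
      (ennreal (v + (norm (post_mean x - m))\<^sup>2) + V) * ennreal (marginal x) / ennreal (marginal x)"
    unfolding posterior_loss_def posterior_normalizer by (simp only: distrib_right)
  also have "\<dots> = ennreal (v + (norm (post_mean x - m))\<^sup>2) + V"
    using M by (intro ennreal_mult_divide_eq) auto
  finally show ?thesis by (simp add: v_def m_def V_def)
qed

lemma posterior_loss_infinite:
  assumes q: "is_pdf q" "second_moment q = \<infinity>"
  shows "posterior_loss \<sigma> \<pi> x q = \<infinity>"
  using marginal_pos[of x] wasserstein_loss_infinite[OF sigma_pos q]
  by (simp add: posterior_loss_def nn_integral_cmult posterior_normalizer ennreal_mult_top ennreal_top_divide)

lemma posterior_loss_post_mean: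
  "posterior_loss \<sigma> \<pi> x (mvn_density \<sigma> (post_mean x)) = ennreal (\<Sum>b\<in>Basis. post_var b x)"
  using posterior_loss_finite[OF is_pdf_mvn_density second_moment_mvn_density, OF sigma_pos sigma_pos]
  by (simp add: pdf_mean_mvn_density wasserstein_loss_mvn_density sigma_pos)

lemma bayes_predictive_density_iff:
  "bayes_predictive_density \<sigma> \<pi> p \<longleftrightarrow>
    predictive_density p \<and> (\<forall>x. is_arg_min (posterior_loss \<sigma> \<pi> x) is_pdf (p x))"
  by (simp add: bayes_predictive_density_def nn_integral_pi)

lemma bayes_post_mean: "bayes_predictive_density \<sigma> \<pi> (\<lambda>x. mvn_density \<sigma> (post_mean x))"
  unfolding bayes_predictive_density_iff
proof (intro conjI allI)
  show "predictive_density (\<lambda>x. mvn_density \<sigma> (post_mean x))"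
    unfolding predictive_density_def using is_pdf_mvn_density[OF sigma_pos] by auto
  fix x
  have "ennreal (\<Sum>b\<in>Basis. post_var b x) \<le> posterior_loss \<sigma> \<pi> x q" if q: "is_pdf q" for q
  proof (cases "second_moment q = \<infinity>")
    case True
    then show ?thesis using posterior_loss_infinite[OF q] by simp
  next
    case False
    then have "second_moment q < \<infinity>" by (simp add: less_top)
    from posterior_loss_finite[OF q this, of x] show ?thesis
      by (simp add: add_increasing2 ennreal_leI)
  qed
  then show "is_arg_min (posterior_loss \<sigma> \<pi> x) is_pdf (mvn_density \<sigma> (post_mean x))"
    using is_pdf_mvn_density[OF sigma_pos]
    by (auto simp: is_arg_min_def posterior_loss_post_mean not_less)
qed

text \<open>The optimal value is the finite trace, which can be cancelled, so both nonnegative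
  excess terms of a minimizer vanish. Zero loss at its own mean is all that is needed of
  \<open>p x\<close>; it need not be identified as a Gaussian density.\<close>

lemma bayes_wasserstein_loss:
  assumes "bayes_predictive_density \<sigma> \<pi> p"
  shows "wasserstein_loss \<sigma> \<theta> (p x) = ennreal ((norm (\<theta> - post_mean x))\<^sup>2)"
proof -
  define v where "v = (\<Sum>b\<in>Basis. post_var b x)"
  have v: "0 \<le> v" by (simp add: v_def sum_nonneg post_var_nonneg)
  have argmin: "is_arg_min (posterior_loss \<sigma> \<pi> x) is_pdf (p x)"
    using assms by (simp add: bayes_predictive_density_iff)
  then have pdf: "is_pdf (p x)"
    by (simp add: is_arg_min_def)
  have le: "posterior_loss \<sigma> \<pi> x (p x) \<le> ennreal v"
    using argmin is_pdf_mvn_density[OF sigma_pos, of "post_mean x"]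
      posterior_loss_post_mean[of x] by (fastforce simp: is_arg_min_def not_less v_def)
  have fin: "second_moment (p x) < \<infinity>"
    using posterior_loss_infinite[OF pdf, of x] le by (auto simp: less_top[symmetric] top_unique)
  let ?m = "pdf_mean (p x)"
  have "ennreal v + (ennreal ((norm (post_mean x - ?m))\<^sup>2) + wasserstein_loss \<sigma> ?m (p x)) \<le> ennreal v + 0"
    using le v unfolding posterior_loss_finite[OF pdf fin]
    by (simp add: v_def[symmetric] ennreal_plus add.assoc)
  then have "ennreal ((norm (post_mean x - ?m))\<^sup>2) + wasserstein_loss \<sigma> ?m (p x) \<le> 0"
    by (subst (asm) ennreal_add_left_cancel_le) simp
  then have "?m = post_mean x" "wasserstein_loss \<sigma> ?m (p x) = 0"
    by (simp_all add: ennreal_eq_0_iff)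
  then show ?thesis
    using wasserstein_loss_decomp[OF sigma_pos pdf fin, of \<theta>] by simp
qed

lemma bayes_minimax:
  assumes "bayes_predictive_density \<sigma> \<pi> p"
  shows "minimax \<sigma> p"
proof -
  have "risk \<sigma> \<theta> p \<le> ennreal (DIM('a) * \<sigma>\<^sup>2)" for \<theta>
    unfolding risk_def bayes_wasserstein_loss[OF assms] by (rule post_mean_risk)
  then have "(SUP \<theta>. risk \<sigma> \<theta> p) \<le> ennreal (DIM('a) * \<sigma>\<^sup>2)"
    by (rule SUP_least)
  moreover have "predictive_density p"
    using assms by (simp add: bayes_predictive_density_iff)
  moreover have "\<not> (SUP \<theta>. risk \<sigma> \<theta> q) < (SUP \<theta>. risk \<sigma> \<theta> p)" if "predictive_density q" for q :: "'a \<Rightarrow> 'a \<Rightarrow> real"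
    using order_trans[OF calculation(1) risk_lower_bound[OF sigma_pos that]] by (simp add: not_less)
  ultimately show ?thesis
    unfolding minimax_def is_arg_min_def by blast
qed

end

theorem corollary3p2:
  fixes \<sigma> :: real and \<pi> :: "'a::euclidean_space \<Rightarrow> ennreal"
  assumes "\<sigma> > 0"
    and "superharmonic_prior \<pi>"
  shows "bayes_predictive_density \<sigma> \<pi> (\<lambda>x. mvn_density \<sigma> (posterior_mean \<sigma> \<pi> x)) \<and>
         (\<forall>p. bayes_predictive_density \<sigma> \<pi> p \<longrightarrow> minimax \<sigma> p)"
proof -
  interpret superharmonic_model \<sigma> \<pi>
    using assms by unfold_locales
  show ?thesis
    using bayes_post_mean bayes_minimax by (simp add: post_mean_def)
qed

end
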